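(* Let $A,B\subseteq\mathbb{R}^2$ be (Lebesgue) measurable sets such that $\overline{\delta}(A,B)>0$. Then there exists $\lambda_0=\lambda_0(A,B)>0$ such that for every $\lambda\geq\lambda_0$ there exist $x\in A$ and $y\in B$ with $|x-y|=\lambda$.
   Context: $|\cdot|$ on $\mathbb{R}^2$ is the Euclidean norm and $\mathbb{1}_S$ is the indicator function of $S$. For measurable $A,B\subseteq\mathbb{R}^2$ the joint upper Banach density is $$\overline{\delta}(A,B):=\sup_{M\geq1}\ \limsup_{R\to+\infty}\ \sup_{z\in\mathbb{R}^2}\ \inf_{M\leq r\leq R/2}\ \frac{1}{(2r)^2R^2}\int_{z+[0,R]^2}\int_{\mathbb{R}^2}\mathbb{1}_A(x)\,\mathbb{1}_B(y)\,\mathbb{1}_{[-r,r]^2}(x-y)\,dy\,dx .$$ *)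

theory Defs
  imports "HOL-Analysis.Analysis"
begin

text \<open>
  The joint upper Banach density of two subsets of the plane. All integrands are nonnegative, so
  the integrals and the lattice operations are taken in \<^typ>\<open>ennreal\<close>. For \<open>R < 2 * M\<close> the
  infimum ranges over the empty set and equals \<open>\<infinity>\<close>; this does not affect the limit superior
  as \<open>R \<longrightarrow> \<infinity>\<close>, which is taken with \<open>M\<close> fixed.
\<close>

definition joint_upper_Banach_density :: "(real ^ 2) set \<Rightarrow> (real ^ 2) set \<Rightarrow> ennreal" where
  "joint_upper_Banach_density A B =
    (SUP M \<in> {1::real..}. Limsup at_top (\<lambda>R::real.
      SUP z :: real ^ 2. INF r \<in> {M..R / 2}.
        ennreal (1 / ((2 * r)\<^sup>2 * R\<^sup>2)) *
        (\<integral>\<^sup>+ x \<in> (+) z ` cbox 0 (\<chi> i. R).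
          (\<integral>\<^sup>+ y. indicator A x * indicator B y * indicator (cbox (\<chi> i. - r) (\<chi> i. r)) (x - y)
            \<partial>lebesgue) \<partial>lebesgue)))"

end

theory Submission
  imports Defs
begin

text \<open>
  The argument is Bourgain's, carried out in physical space. Suppose arbitrarily large distances
  \<open>l\<close> are missed, pick a rapidly growing sequence of them, and separate them by grid scales
  \<open>\<rho>\<close> and \<open>L\<close> with \<open>\<rho>\<close> much smaller and \<open>L\<close> much larger than \<open>l\<close>. On a large square, write the
  indicator function \<open>g\<close> of \<open>B\<close> as its average over cells of side \<open>L\<close>, plus the difference of the averages
  over cells of sides \<open>\<rho>\<close> and \<open>L\<close>, plus the remainder, and average over arcs of radius \<open>l\<close>. The
  first part is almost invariant under translations of length \<open>l\<close>, and the density hypothesis bounds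
  its correlation with \<open>A\<close> from below. The second part is small in \<open>L\<^sup>2\<close> for at least one of the chosen
  distances, because the averages at nested scales are orthogonal projections. The circular average
  of the third part is small in \<open>L\<^sup>2\<close> for every distance: its square expands into autocorrelations at
  differences of two points on an arc, these differences have an integrable density, and an
  autocorrelation averaged against an integrable density does not see mean-zero oscillations on small cells.
\<close>

section \<open>Averages over grid cells\<close>

lemma borel_measurable_vec_nth [measurable]: "(\<lambda>x::real^'n. x $ i) \<in> borel_measurable borel"
  by (intro borel_measurable_continuous_onI continuous_intros)

text \<open>For \<open>\<rho> > 0\<close> the cells are the half-open squares of a grid through the
  origin. Coding them by floors makes them partition the whole plane, boundaries included.\<close>

definition same_cell :: "real \<Rightarrow> real^2 \<Rightarrow> real^2 \<Rightarrow> bool" where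
  "same_cell \<rho> x y \<longleftrightarrow> (\<forall>i. \<lfloor>x $ i / \<rho>\<rfloor> = \<lfloor>y $ i / \<rho>\<rfloor>)"

lemma same_cell_sym: "same_cell \<rho> x y \<longleftrightarrow> same_cell \<rho> y x"
  by (auto simp: same_cell_def)

lemma same_cell_trans: "same_cell \<rho> x y \<Longrightarrow> same_cell \<rho> y z \<Longrightarrow> same_cell \<rho> x z"
  by (auto simp: same_cell_def)

text \<open>The floor of \<open>t / (n * \<rho>)\<close> is the integer quotient of the floor of
  \<open>t / \<rho>\<close> by \<open>n\<close>. Grids with integer scale ratio are therefore
  nested, which later makes the averages nested projections.\<close>

lemma same_cell_multiple:
  assumes "same_cell \<rho> x y" "\<rho> > 0"
  shows "same_cell (of_nat n * \<rho>) x y"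
proof -
  have "\<lfloor>t / (of_nat n * \<rho>)\<rfloor> = \<lfloor>t / \<rho>\<rfloor> div int n" for t :: real
    using floor_divide_real_eq_div[of "int n" "t / \<rho>"] by (simp add: field_simps)
  with assms show ?thesis by (auto simp: same_cell_def)
qed

lemma pred_same_cell [measurable]:
  assumes [measurable]: "f \<in> M \<rightarrow>\<^sub>M borel" "g \<in> M \<rightarrow>\<^sub>M borel"
  shows "Measurable.pred M (\<lambda>p. same_cell \<rho> (f p) (g p))"
  unfolding same_cell_def by measurable

text \<open>The height is the reciprocal of the cell area. For \<open>\<rho> > 0\<close> this is the
  symmetric probability kernel of the conditional expectation onto cell-constant functions.\<close>

definition cell_kernel :: "real \<Rightarrow> real^2 \<Rightarrow> real^2 \<Rightarrow> real" where
  "cell_kernel \<rho> x y = (if same_cell \<rho> x y then 1 / \<rho>\<^sup>2 else 0)"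

lemma cell_kernel_nonneg [simp]: "cell_kernel \<rho> x y \<ge> 0"
  by (simp add: cell_kernel_def)

lemma cell_kernel_le: "cell_kernel \<rho> x y \<le> 1 / \<rho>\<^sup>2"
  by (simp add: cell_kernel_def)

lemma cell_kernel_sym: "cell_kernel \<rho> x y = cell_kernel \<rho> y x"
  by (simp add: cell_kernel_def same_cell_sym)

lemma borel_measurable_cell_kernel [measurable]:
  assumes [measurable]: "f \<in> M \<rightarrow>\<^sub>M borel" "g \<in> M \<rightarrow>\<^sub>M borel"
  shows "(\<lambda>p. cell_kernel \<rho> (f p) (g p)) \<in> borel_measurable M"
  unfolding cell_kernel_def by measurable

section \<open>Areas of boxes and grid cells\<close>

lemma measure_lborel_cbox_2:
  fixes a b :: "real^2"
  assumes "a $ 1 \<le> b $ 1" "a $ 2 \<le> b $ 2"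
  shows "measure lborel (cbox a b) = (b $ 1 - a $ 1) * (b $ 2 - a $ 2)"
proof -
  have "cbox a b \<noteq> {}" using assms
    by (simp add: interval_ne_empty_cart forall_2)
  then show ?thesis by (simp add: content_cbox_cart UNIV_2)
qed

lemma emeasure_lborel_cbox_2:
  fixes a b :: "real^2"
  assumes "a $ 1 \<le> b $ 1" "a $ 2 \<le> b $ 2"
  shows "emeasure lborel (cbox a b) = ennreal ((b $ 1 - a $ 1) * (b $ 2 - a $ 2))"
  using measure_lborel_cbox_2[OF assms] emeasure_eq_ennreal_measure[of lborel "cbox a b"]
  by (simp add: emeasure_lborel_cbox_eq)

text \<open>A half-open cell lies between an open box and its closure, and these have equal
  area.\<close>

lemma emeasure_same_cell:
  assumes "\<rho> > 0"
  shows "emeasure lborel {y. same_cell \<rho> x y} = ennreal (\<rho>\<^sup>2)"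
proof -
  define a :: "real^2" where "a = (\<chi> i. of_int \<lfloor>x $ i / \<rho>\<rfloor> * \<rho>)"
  define b :: "real^2" where "b = (\<chi> i. of_int (\<lfloor>x $ i / \<rho>\<rfloor> + 1) * \<rho>)"
  have fl: "\<lfloor>t / \<rho>\<rfloor> = k \<longleftrightarrow> of_int k * \<rho> \<le> t \<and> t < of_int (k + 1) * \<rho>" for t k
    using assms by (auto simp: floor_eq_iff field_simps)
  have cell: "same_cell \<rho> x y \<longleftrightarrow> (\<forall>i. of_int \<lfloor>x $ i / \<rho>\<rfloor> * \<rho> \<le> y $ i \<and> y $ i < of_int (\<lfloor>x $ i / \<rho>\<rfloor> + 1) * \<rho>)" for y
    unfolding same_cell_def by (subst fl[symmetric]) (metis)
  have sub: "box a b \<subseteq> {y. same_cell \<rho> x y}" "{y. same_cell \<rho> x y} \<subseteq> cbox a b"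
    using cell by (auto simp: a_def b_def mem_box_cart less_imp_le)
  have ab: "a $ i \<le> b $ i" "b $ i - a $ i = \<rho>" for i
    using assms by (auto simp: a_def b_def algebra_simps)
  have "emeasure lborel (cbox a b) = ennreal (\<rho>\<^sup>2)"
    by (subst emeasure_lborel_cbox_2) (auto simp: ab power2_eq_square)
  moreover have "emeasure lborel (box a b) = emeasure lborel (cbox a b)"
    by (simp add: emeasure_lborel_cbox_eq emeasure_lborel_box_eq)
  moreover have "emeasure lborel (box a b) \<le> emeasure lborel {y. same_cell \<rho> x y}"
    "emeasure lborel {y. same_cell \<rho> x y} \<le> emeasure lborel (cbox a b)"
    by (intro emeasure_mono sub; measurable)+
  ultimately show ?thesis by (metis order_antisym)
qed

lemma cell_kernel_eq: "cell_kernel \<rho> x y = indicator {y. same_cell \<rho> x y} y / \<rho>\<^sup>2"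
  by (simp add: cell_kernel_def)

lemma
  assumes "\<rho> > 0"
  shows integrable_cell_kernel: "integrable lborel (cell_kernel \<rho> x)"
    and integral_cell_kernel: "(LINT y|lborel. cell_kernel \<rho> x y) = 1"
proof -
  have "integrable lborel (indicat_real {y. same_cell \<rho> x y})"
    using emeasure_same_cell[OF assms] by (intro integrable_real_indicator) measurable
  then show "integrable lborel (cell_kernel \<rho> x)"
    unfolding cell_kernel_eq[abs_def] by simp
  show "(LINT y|lborel. cell_kernel \<rho> x y) = 1"
    unfolding cell_kernel_eq using emeasure_same_cell[OF assms, of x] assms
    by (simp add: measure_def)
qed

lemma integrable_mult_bounded:
  fixes f g :: "'a \<Rightarrow> real"
  assumes "integrable M g" "f \<in> borel_measurable M" "\<And>x. \<bar>f x\<bar> \<le> B"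
  shows "integrable M (\<lambda>x. f x * g x)"
proof (rule Bochner_Integration.integrable_bound)
  show "integrable M (\<lambda>x. B * g x)" using assms by simp
  show "AE x in M. norm (f x * g x) \<le> norm (B * g x)"
    using assms(3) by (intro AE_I2) (simp add: abs_mult mult_right_mono order_trans[OF _ abs_ge_self])
qed (use assms in measurable)

section \<open>The averaging operator as an orthogonal projection\<close>

definition cell_avg :: "real \<Rightarrow> (real^2 \<Rightarrow> real) \<Rightarrow> real^2 \<Rightarrow> real" where
  "cell_avg \<rho> g x = (LINT y|lborel. cell_kernel \<rho> x y * g y)"

lemma cell_avg_cong:
  assumes "same_cell \<rho> x y"
  shows "cell_avg \<rho> g x = cell_avg \<rho> g y"
proof -
  have "same_cell \<rho> x z \<longleftrightarrow> same_cell \<rho> y z" for z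
    using assms by (metis same_cell_trans same_cell_sym)
  then show ?thesis by (simp add: cell_avg_def cell_kernel_def)
qed

lemma borel_measurable_cell_avg [measurable]:
  assumes [measurable]: "g \<in> borel_measurable borel"
  shows "cell_avg \<rho> g \<in> borel_measurable borel"
  unfolding cell_avg_def by measurable

lemma integrable_cell_kernel_mult:
  assumes "integrable lborel g"
  shows "integrable lborel (\<lambda>y. cell_kernel \<rho> x y * g y)"
  by (rule integrable_mult_bounded[OF assms, where B="1/\<rho>\<^sup>2"]) (auto simp: cell_kernel_le)

text \<open>On the cell of \<open>x\<close> the function may be replaced by the constant
  \<open>g x\<close>, and the kernel has mass one. Applied at every point, this gives idempotence
  and absorption between nested grids.\<close>

lemma cell_avg_locally_const:
  assumes "\<rho> > 0" "\<And>y. same_cell \<rho> x y \<Longrightarrow> g y = g x"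
  shows "cell_avg \<rho> g x = g x"
proof -
  have "cell_kernel \<rho> x y * g y = cell_kernel \<rho> x y * g x" for y
    using assms(2)[of y] by (cases "same_cell \<rho> x y") (simp_all add: cell_kernel_def)
  then have "cell_avg \<rho> g x = (LINT y|lborel. cell_kernel \<rho> x y * g x)"
    unfolding cell_avg_def by metis
  also have "\<dots> = g x" using integral_cell_kernel[OF assms(1)] by simp
  finally show ?thesis .
qed

lemma cell_avg_bounds:
  assumes "\<rho> > 0" "integrable lborel g" "\<And>x. 0 \<le> g x" "\<And>x. g x \<le> 1"
  shows "0 \<le> cell_avg \<rho> g x" "cell_avg \<rho> g x \<le> 1"
proof -
  show "0 \<le> cell_avg \<rho> g x"
    unfolding cell_avg_def using assms by (intro Bochner_Integration.integral_nonneg) auto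
  have "cell_avg \<rho> g x \<le> (LINT y|lborel. cell_kernel \<rho> x y)"
    unfolding cell_avg_def using assms
    by (intro integral_mono integrable_cell_kernel integrable_cell_kernel_mult) (auto intro: mult_left_le)
  then show "cell_avg \<rho> g x \<le> 1" using integral_cell_kernel[OF assms(1)] by simp
qed

text \<open>For fixed \<open>y\<close> the kernel has mass one in \<open>x\<close>, so the inner
  integral of the absolute value is at most \<open>B * \<bar>g y\<bar>\<close>, and Fubini's
  criterion applies.\<close>

lemma integrable_cell_kernel_pair:
  assumes "\<rho> > 0" "integrable lborel f" "\<And>x. \<bar>f x\<bar> \<le> B" "integrable lborel g"
  shows "integrable (lborel \<Otimes>\<^sub>M lborel) (\<lambda>(y, x). cell_kernel \<rho> x y * f x * g y)"
proof -
  have [measurable]: "f \<in> borel_measurable borel" "g \<in> borel_measurable borel"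
    using assms by (auto dest: borel_measurable_integrable)
  have B: "B \<ge> 0" using assms(3)[of 0] by linarith
  have int: "integrable lborel (\<lambda>x. cell_kernel \<rho> x y * f x * g y)" for y
    using integrable_mult_left[where c="g y", OF integrable_cell_kernel_mult[OF assms(2), of \<rho> y]]
    by (simp add: cell_kernel_sym[of \<rho> y])
  have le: "(LINT x|lborel. norm (cell_kernel \<rho> x y * f x * g y)) \<le> B * \<bar>g y\<bar>" for y
  proof -
    have "(LINT x|lborel. norm (cell_kernel \<rho> x y * f x * g y)) \<le> (LINT x|lborel. cell_kernel \<rho> y x * (B * \<bar>g y\<bar>))"
    proof (intro integral_mono integrable_norm int)
      show "integrable lborel (\<lambda>x. cell_kernel \<rho> y x * (B * \<bar>g y\<bar>))"
        using integrable_cell_kernel[OF assms(1)] by (intro integrable_mult_left)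
      show "norm (cell_kernel \<rho> x y * f x * g y) \<le> cell_kernel \<rho> y x * (B * \<bar>g y\<bar>)" for x
        using assms(3)[of x] by (simp add: abs_mult cell_kernel_sym[of \<rho> y] mult_left_mono mult_right_mono mult.assoc)
    qed
    then show ?thesis using integral_cell_kernel[OF assms(1), of y] by simp
  qed
  have bound: "integrable lborel (\<lambda>y. LINT x|lborel. norm (cell_kernel \<rho> x y * f x * g y))"
  proof (rule Bochner_Integration.integrable_bound)
    show "integrable lborel (\<lambda>y. B * \<bar>g y\<bar>)" using assms(4) by simp
    show "AE y in lborel. norm (LINT x|lborel. norm (cell_kernel \<rho> x y * f x * g y)) \<le> norm (B * \<bar>g y\<bar>)"
    proof (rule AE_I2)
      fix y
      have "0 \<le> (LINT x|lborel. norm (cell_kernel \<rho> x y * f x * g y))" by simp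
      then show "norm (LINT x|lborel. norm (cell_kernel \<rho> x y * f x * g y)) \<le> norm (B * \<bar>g y\<bar>)"
        using le[of y] unfolding real_norm_def by linarith
    qed
  qed measurable
  show ?thesis
    by (rule lborel_pair.Fubini_integrable) (use int bound in auto)
qed

text \<open>The kernel is symmetric, so exchanging the order of integration moves the average from
  one factor to the other.\<close>

lemma cell_avg_self_adjoint:
  assumes "\<rho> > 0" "integrable lborel f" "\<And>x. \<bar>f x\<bar> \<le> B" "integrable lborel g"
  shows "(LINT x|lborel. f x * cell_avg \<rho> g x) = (LINT x|lborel. cell_avg \<rho> f x * g x)"
    and "integrable lborel (\<lambda>x. f x * cell_avg \<rho> g x)"
proof -
  note int = integrable_cell_kernel_pair[OF assms]
  have 1: "(\<lambda>x. LINT y|lborel. cell_kernel \<rho> x y * f x * g y) = (\<lambda>x. f x * cell_avg \<rho> g x)"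
    unfolding cell_avg_def integral_mult_right_zero[symmetric]
    by (intro ext Bochner_Integration.integral_cong) (auto simp: mult_ac)
  have 2: "(\<lambda>y. LINT x|lborel. cell_kernel \<rho> x y * f x * g y) = (\<lambda>y. cell_avg \<rho> f y * g y)"
    unfolding cell_avg_def integral_mult_left_zero[symmetric]
    by (intro ext Bochner_Integration.integral_cong) (auto simp: cell_kernel_sym)
  show "(LINT x|lborel. f x * cell_avg \<rho> g x) = (LINT x|lborel. cell_avg \<rho> f x * g x)"
    using lborel_pair.Fubini_integral[OF int] 1 2 by simp
  show "integrable lborel (\<lambda>x. f x * cell_avg \<rho> g x)"
    using lborel_pair.integrable_snd[OF int] 1 by simp
qed

lemma
  assumes "\<rho> > 0" "integrable lborel g"
  shows integrable_cell_avg: "integrable lborel (cell_avg \<rho> g)"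
    and integral_cell_avg: "(LINT x|lborel. cell_avg \<rho> g x) = (LINT x|lborel. g x)"
proof -
  have [measurable]: "g \<in> borel_measurable borel"
    using assms by (auto dest: borel_measurable_integrable)
  have int: "integrable lborel (\<lambda>x. cell_kernel \<rho> x y * g y)" for y
    using integrable_mult_left[where c="g y", OF integrable_cell_kernel[OF assms(1), of y]]
    by (simp add: cell_kernel_sym[of \<rho> y])
  have "(LINT x|lborel. norm (cell_kernel \<rho> x y * g y)) = \<bar>g y\<bar>" for y
    using integral_cell_kernel[OF assms(1), of y] by (simp add: abs_mult cell_kernel_sym[of \<rho> y])
  then have pair: "integrable (lborel \<Otimes>\<^sub>M lborel) (\<lambda>(y, x). cell_kernel \<rho> x y * g y)"
    by (intro lborel_pair.Fubini_integrable) (use int assms in auto)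
  from lborel_pair.integrable_snd[OF pair] show "integrable lborel (cell_avg \<rho> g)"
    unfolding cell_avg_def[abs_def] by simp
  have "(LINT x|lborel. cell_kernel \<rho> x y) = 1" for y
    using integral_cell_kernel[OF assms(1), of y] by (simp add: cell_kernel_sym[of \<rho> y])
  then show "(LINT x|lborel. cell_avg \<rho> g x) = (LINT x|lborel. g x)"
    using lborel_pair.Fubini_integral[OF pair] by (simp add: cell_avg_def)
qed

text \<open>Pythagoras for nested projections: the cross term and both squares reduce to energies,
  integrals of \<open>g\<close> against its own averages. As a difference of energies the right side
  telescopes along a sequence of scales.\<close>

lemma cell_avg_energy_increment:
  assumes \<rho>: "\<rho> > 0" and n: "n > 0" and g: "integrable lborel g" "\<And>x. 0 \<le> g x" "\<And>x. g x \<le> 1"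
  defines "\<sigma> \<equiv> of_nat n * \<rho>"
  shows "(LINT x|lborel. (cell_avg \<rho> g x - cell_avg \<sigma> g x)\<^sup>2) =
    (LINT x|lborel. g x * cell_avg \<rho> g x) - (LINT x|lborel. g x * cell_avg \<sigma> g x)"
proof -
  have \<sigma>: "\<sigma> > 0" using \<rho> n by (simp add: \<sigma>_def)
  have [measurable]: "g \<in> borel_measurable borel"
    using g by (auto dest: borel_measurable_integrable)
  have g1: "\<bar>g x\<bar> \<le> 1" for x using g(2,3)[of x] by simp
  have E1: "\<bar>cell_avg \<tau> g x\<bar> \<le> 1" if "\<tau> > 0" for x \<tau> using cell_avg_bounds[OF that g, of x] by simp
  have Ei: "integrable lborel (cell_avg \<tau> g)" if "\<tau> > 0" for \<tau>
    using integrable_cell_avg[OF that g(1)] .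
  have Ii: "integrable lborel (\<lambda>x. cell_avg \<tau> g x * cell_avg \<tau>' g x)" if "\<tau> > 0" "\<tau>' > 0" for \<tau> \<tau>'
    using integrable_mult_bounded[OF Ei[OF that(2)], of "cell_avg \<tau> g" 1] E1[OF that(1)] by auto
  \<comment> \<open>Averages over cells of side \<open>\<sigma>\<close> are constant on cells of
    side \<open>\<rho>\<close>, because \<open>\<sigma>\<close> is an integer multiple of
    \<open>\<rho>\<close>.\<close>
  have nest: "cell_avg \<rho> (cell_avg \<tau> g) x = cell_avg \<tau> g x" if "\<tau> = \<rho> \<or> \<tau> = \<sigma>" for x \<tau>
    using that same_cell_multiple[of \<rho> _ _ n] \<rho>
    by (intro cell_avg_locally_const) (auto simp: \<sigma>_def same_cell_sym[of _ x] intro!: cell_avg_cong)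
  \<comment> \<open>Self-adjointness moves the \<open>\<rho>\<close>-average from \<open>g\<close>
    onto \<open>cell_avg \<tau> g\<close>, where \<open>nest\<close> absorbs it.\<close>
  have prod: "(LINT x|lborel. cell_avg \<rho> g x * cell_avg \<tau> g x) = (LINT x|lborel. g x * cell_avg \<tau> g x)"
    if "\<tau> = \<rho> \<or> \<tau> = \<sigma>" for \<tau>
    using cell_avg_self_adjoint(1)[OF \<rho> g(1) g1, of "cell_avg \<tau> g"] that \<rho> \<sigma> Ei nest by auto
  have nest': "cell_avg \<sigma> (cell_avg \<sigma> g) x = cell_avg \<sigma> g x" for x
    using \<sigma> by (intro cell_avg_locally_const) (auto simp: same_cell_sym[of _ x] intro!: cell_avg_cong)
  have prod': "(LINT x|lborel. cell_avg \<sigma> g x * cell_avg \<sigma> g x) = (LINT x|lborel. g x * cell_avg \<sigma> g x)"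
    using cell_avg_self_adjoint(1)[OF \<sigma> g(1) g1, of "cell_avg \<sigma> g"] \<sigma> Ei nest' by auto
  have "(LINT x|lborel. (cell_avg \<rho> g x - cell_avg \<sigma> g x)\<^sup>2) =
    (LINT x|lborel. (cell_avg \<rho> g x * cell_avg \<rho> g x - 2 * (cell_avg \<rho> g x * cell_avg \<sigma> g x)) + cell_avg \<sigma> g x * cell_avg \<sigma> g x)"
    by (simp add: power2_eq_square algebra_simps)
  also have "\<dots> = (LINT x|lborel. cell_avg \<rho> g x * cell_avg \<rho> g x) - 2 * (LINT x|lborel. cell_avg \<rho> g x * cell_avg \<sigma> g x)
     + (LINT x|lborel. cell_avg \<sigma> g x * cell_avg \<sigma> g x)"
    using Ii \<rho> \<sigma> by (simp del: mult_cancel_left)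
  finally show ?thesis using prod prod' by simp
qed

section \<open>Grid boundaries\<close>

lemma same_cell_dist:
  assumes "same_cell \<rho> x y" "\<rho> > 0"
  shows "\<bar>x $ i - y $ i\<bar> < \<rho>"
proof -
  have "\<lfloor>x $ i / \<rho>\<rfloor> = \<lfloor>y $ i / \<rho>\<rfloor>" using assms by (simp add: same_cell_def)
  then have "\<bar>x $ i / \<rho> - y $ i / \<rho>\<bar> < 1" by linarith
  then show ?thesis using assms(2)
    by (simp add: diff_divide_distrib[symmetric] abs_div_pos[symmetric] del: abs_divide)
qed

section \<open>Squares, slabs and neighbourhoods of grid lines\<close>

definition square :: "real^2 \<Rightarrow> real \<Rightarrow> (real^2) set" where
  "square z s = cbox z (\<chi> i. z $ i + s)"

lemma mem_square: "x \<in> square z s \<longleftrightarrow> (\<forall>i. z $ i \<le> x $ i \<and> x $ i \<le> z $ i + s)"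
  by (simp add: square_def mem_box_cart)

lemma sets_square [measurable]: "square z s \<in> sets borel"
  by (simp add: square_def)

lemma emeasure_square: "s \<ge> 0 \<Longrightarrow> emeasure lborel (square z s) = ennreal (s\<^sup>2)"
  unfolding square_def by (subst emeasure_lborel_cbox_2) (auto simp: power2_eq_square)

lemma emeasure_slab_le:
  assumes "s \<ge> 0" "r \<ge> 0"
  shows "emeasure lborel {y \<in> square z s. \<bar>y $ i - w\<bar> \<le> r} \<le> ennreal (2 * r * s)"
proof -
  define a :: "real^2" where "a = (\<chi> j. if j = i then w - r else z $ j)"
  define b :: "real^2" where "b = (\<chi> j. if j = i then w + r else z $ j + s)"
  have "{y \<in> square z s. \<bar>y $ i - w\<bar> \<le> r} \<subseteq> cbox a b"
    by (auto simp: a_def b_def mem_square mem_box_cart)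
  then have "emeasure lborel {y \<in> square z s. \<bar>y $ i - w\<bar> \<le> r} \<le> emeasure lborel (cbox a b)"
    by (intro emeasure_mono) auto
  also have "\<dots> = ennreal ((b $ 1 - a $ 1) * (b $ 2 - a $ 2))"
    using assms by (intro emeasure_lborel_cbox_2) (auto simp: a_def b_def)
  also have "(b $ 1 - a $ 1) * (b $ 2 - a $ 2) = 2 * r * s"
    using exhaust_2[of i] by (auto simp: a_def b_def)
  finally show ?thesis .
qed

definition near_grid :: "real \<Rightarrow> real \<Rightarrow> (real^2) set" where
  "near_grid L r = {x. \<exists>i. \<exists>k::int. \<bar>x $ i - of_int k * L\<bar> \<le> r}"

lemma sets_near_grid [measurable]: "near_grid L r \<in> sets borel"
  unfolding near_grid_def by measurable

text \<open>If the floors differ in some coordinate, a grid line separates the two values of that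
  coordinate, and these are at most \<open>r\<close> apart.\<close>

lemma not_same_cell_imp_near_grid:
  assumes L: "L > 0" and r: "\<And>i. \<bar>x $ i - y $ i\<bar> \<le> r" and nc: "\<not> same_cell L x y"
  shows "x \<in> near_grid L r"
proof -
  obtain i where i: "\<lfloor>x $ i / L\<rfloor> \<noteq> \<lfloor>y $ i / L\<rfloor>"
    using nc by (auto simp: same_cell_def)
  have fl: "of_int k * L \<le> t" if "k \<le> \<lfloor>t / L\<rfloor>" for k t
    using that L by (simp add: le_floor_iff field_simps)
  have fl': "t < of_int k * L" if "k > \<lfloor>t / L\<rfloor>" for k t
    using that L by (simp add: floor_less_iff field_simps)
  have "\<exists>k::int. \<bar>x $ i - of_int k * L\<bar> \<le> r"
  \<comment> \<open>The witness is the larger of the two floors: its multiple of \<open>L\<close>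
    lies between the two coordinates, in whichever order they come.\<close>
  proof (cases "\<lfloor>x $ i / L\<rfloor> < \<lfloor>y $ i / L\<rfloor>")
    case True
    with fl'[OF True] fl[OF order_refl, of "y $ i"] r[of i] show ?thesis
      by (intro exI[of _ "\<lfloor>y $ i / L\<rfloor>"]) auto
  next
    case False
    then have "\<lfloor>x $ i / L\<rfloor> > \<lfloor>y $ i / L\<rfloor>" using i by simp
    from fl'[OF this] fl[OF order_refl, of "x $ i"] r[of i] show ?thesis
      by (intro exI[of _ "\<lfloor>x $ i / L\<rfloor>"]) auto
  qed
  then show ?thesis by (auto simp: near_grid_def)
qed

text \<open>In each of the two directions at most \<open>4 * R / L\<close> grid lines come within
  \<open>r\<close> of the square, and each contributes a slab of area at most
  \<open>2 * r * R\<close>.\<close>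

lemma emeasure_near_grid_le:
  assumes "0 \<le> r" "r \<le> L" "L \<le> R" "0 < L"
  shows "emeasure lborel (near_grid L r \<inter> square z R) \<le> ennreal (16 * (r / L) * R\<^sup>2)"
proof -
  \<comment> \<open>The indices of the lines normal to direction \<open>i\<close> that come within
    \<open>r\<close> of the square. There are at most \<open>(R + 2 * r) / L + 1\<close> of them,
    which is at most \<open>4 * R / L\<close> because \<open>r \<le> L \<le> R\<close>.\<close>
  define K where "K = (\<lambda>i::2. {\<lceil>(z $ i - r) / L\<rceil> .. \<lfloor>(z $ i + R + r) / L\<rfloor>})"
  have card: "real (card (K i)) \<le> 4 * R / L" for i
  proof -
    have "of_int \<lfloor>(z $ i + R + r) / L\<rfloor> - of_int \<lceil>(z $ i - r) / L\<rceil> + 1 \<le> (z $ i + R + r) / L - (z $ i - r) / L + 1"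
      by linarith
    also have "\<dots> = (R + 2 * r + L) / L" using assms by (simp add: field_simps)
    also have "\<dots> \<le> 4 * R / L" using assms by (intro divide_right_mono) auto
    finally have "of_int \<lfloor>(z $ i + R + r) / L\<rfloor> - of_int \<lceil>(z $ i - r) / L\<rceil> + 1 \<le> 4 * R / L" .
    moreover have "0 \<le> 4 * R / L" using assms by simp
    ultimately show ?thesis by (auto simp: K_def of_nat_nat)
  qed
  have "near_grid L r \<inter> square z R \<subseteq> (\<Union>i. \<Union>k\<in>K i. {y \<in> square z R. \<bar>y $ i - of_int k * L\<bar> \<le> r})"
  proof
    fix x assume x: "x \<in> near_grid L r \<inter> square z R"
    then obtain i k where k: "\<bar>x $ i - of_int k * L\<bar> \<le> r" by (auto simp: near_grid_def)
    have "z $ i \<le> x $ i" "x $ i \<le> z $ i + R" using x by (auto simp: mem_square)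
    then have "z $ i - r \<le> of_int k * L" "of_int k * L \<le> z $ i + R + r" using k by linarith+
    then have "k \<in> K i" using assms by (auto simp: K_def ceiling_le_iff le_floor_iff field_simps)
    with k x show "x \<in> (\<Union>i. \<Union>k\<in>K i. {y \<in> square z R. \<bar>y $ i - of_int k * L\<bar> \<le> r})" by blast
  qed
  then have "emeasure lborel (near_grid L r \<inter> square z R)
    \<le> emeasure lborel (\<Union>i. \<Union>k\<in>K i. {y \<in> square z R. \<bar>y $ i - of_int k * L\<bar> \<le> r})"
    by (intro emeasure_mono) (auto simp: K_def)
  also have "\<dots> \<le> (\<Sum>i\<in>UNIV. emeasure lborel (\<Union>k\<in>K i. {y \<in> square z R. \<bar>y $ i - of_int k * L\<bar> \<le> r}))"
    by (intro emeasure_subadditive_finite) (auto simp: K_def)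
  also have "\<dots> \<le> (\<Sum>i\<in>UNIV. \<Sum>k\<in>K i. emeasure lborel {y \<in> square z R. \<bar>y $ i - of_int k * L\<bar> \<le> r})"
    by (intro sum_mono emeasure_subadditive_finite) (auto simp: K_def)
  also have "\<dots> \<le> (\<Sum>i\<in>(UNIV::2 set). \<Sum>k\<in>K i. ennreal (2 * r * R))"
    using assms by (intro sum_mono emeasure_slab_le) auto
  also have "\<dots> = (\<Sum>i\<in>(UNIV::2 set). ennreal (real (card (K i)) * (2 * r * R)))"
    using assms by (simp add: ennreal_mult ennreal_of_nat_eq_real_of_nat)
  also have "\<dots> \<le> (\<Sum>i\<in>(UNIV::2 set). ennreal (4 * R / L * (2 * r * R)))"
    using assms card by (intro sum_mono ennreal_leI mult_right_mono) auto
  also have "\<dots> = ennreal (2 * (4 * R / L * (2 * r * R)))"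
    using assms by (subst ennreal_mult) auto
  also have "2 * (4 * R / L * (2 * r * R)) = 16 * (r / L) * R\<^sup>2"
    by (simp add: power2_eq_square)
  finally show ?thesis .
qed

text \<open>By self-adjointness the averaging passes from \<open>g\<close> to the indicator of the
  box. The indicator agrees with its average except on cells cut by the boundary, so only the area
  of a boundary layer remains.\<close>

lemma box_boundary_integral_le:
  fixes l u :: "real^2"
  assumes \<rho>: "\<rho> > 0" and g: "integrable lborel g" "\<And>x. 0 \<le> g x" "\<And>x. g x \<le> 1"
    and s: "s \<ge> 0" "\<And>i. u $ i - l $ i \<le> s"
  shows "\<bar>LINT y|lborel. indicator (box l u) y * (g y - cell_avg \<rho> g y)\<bar> \<le> 8 * \<rho> * (s + 2 * \<rho>)"
proof -
  define D where "D = box l u"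
  define d :: "real^2 \<Rightarrow> real" where "d = indicator D"
  define S where "S = square (\<chi> i. l $ i - \<rho>) (s + 2 * \<rho>)"
  \<comment> \<open>Four strips of half-width \<open>\<rho>\<close>, one along each side. They lie
    in the square \<open>S\<close> of side \<open>s + 2 * \<rho>\<close>, so their total area is at
    most \<open>8 * \<rho> * (s + 2 * \<rho>)\<close>.\<close>
  define F where "F = (\<Union>i. {y \<in> S. \<bar>y $ i - l $ i\<bar> \<le> \<rho>} \<union> {y \<in> S. \<bar>y $ i - u $ i\<bar> \<le> \<rho>})"
  have [measurable]: "g \<in> borel_measurable borel" "D \<in> sets borel" "F \<in> sets borel" "d \<in> borel_measurable borel"
    using g by (auto dest: borel_measurable_integrable simp: D_def F_def S_def d_def)
  have g1: "\<bar>g x\<bar> \<le> 1" for x using g(2,3)[of x] by simp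
  have d1: "0 \<le> d x" "d x \<le> 1" "\<bar>d x\<bar> \<le> 1" for x by (auto simp: d_def indicator_def)
  have dI: "integrable lborel d"
    unfolding d_def D_def using emeasure_lborel_box_finite[of l u] by (intro integrable_real_indicator) auto
  have mD: "x \<in> D \<longleftrightarrow> (\<forall>i. l $ i < x $ i \<and> x $ i < u $ i)" for x
    by (auto simp: D_def mem_box_cart)
  \<comment> \<open>When a cell meets both \<open>D\<close> and its complement, one of the
    coordinate inequalities defining \<open>D\<close> changes within a distance
    \<open>\<rho>\<close>.\<close>
  have mF: "y \<in> F" if C: "same_cell \<rho> y y'" "y \<in> D \<longleftrightarrow> y' \<notin> D" for y y'
  proof -
    have c: "\<bar>y $ i - y' $ i\<bar> < \<rho>" for i using same_cell_dist[OF C(1) \<rho>] .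
    obtain w where w: "w = y \<or> w = y'" "w \<in> D" using C(2) by metis
    have "y \<in> S" unfolding S_def mem_square
    proof
      fix i show "(\<chi> i. l $ i - \<rho>) $ i \<le> y $ i \<and> y $ i \<le> (\<chi> i. l $ i - \<rho>) $ i + (s + 2 * \<rho>)"
        using w c[of i] s(2)[of i] mD[of w] \<rho> by (auto dest!: spec[of _ i])
    qed
    moreover have "\<exists>i. \<bar>y $ i - l $ i\<bar> \<le> \<rho> \<or> \<bar>y $ i - u $ i\<bar> \<le> \<rho>"
    proof -
      obtain i where "\<not> (l $ i < y $ i \<and> y $ i < u $ i \<longleftrightarrow> l $ i < y' $ i \<and> y' $ i < u $ i)"
        using C(2) mD by metis
      then show ?thesis using c[of i] by (intro exI[of _ i]) linarith
    qed
    ultimately show ?thesis by (auto simp: F_def)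
  qed
  have loc: "cell_avg \<rho> d y = d y" if "y \<notin> F" for y
    by (intro cell_avg_locally_const \<rho>) (use mF that in \<open>auto simp: d_def indicator_def\<close>)
  have diff: "\<bar>d y - cell_avg \<rho> d y\<bar> \<le> indicator F y" for y
    using loc[of y] cell_avg_bounds[OF \<rho> dI d1(1,2), of y] d1(1,2)[of y] by (cases "y \<in> F") auto
  have F: "emeasure lborel F \<le> ennreal (8 * \<rho> * (s + 2 * \<rho>))"
  proof -
    have "emeasure lborel F \<le> (\<Sum>i\<in>UNIV. emeasure lborel ({y \<in> S. \<bar>y $ i - l $ i\<bar> \<le> \<rho>} \<union> {y \<in> S. \<bar>y $ i - u $ i\<bar> \<le> \<rho>}))"
      unfolding F_def S_def by (intro emeasure_subadditive_finite) auto
    also have "\<dots> \<le> (\<Sum>i\<in>UNIV. emeasure lborel {y \<in> S. \<bar>y $ i - l $ i\<bar> \<le> \<rho>} + emeasure lborel {y \<in> S. \<bar>y $ i - u $ i\<bar> \<le> \<rho>})"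
      unfolding S_def by (intro sum_mono emeasure_subadditive) auto
    also have "\<dots> \<le> (\<Sum>i\<in>(UNIV::2 set). ennreal (2 * \<rho> * (s + 2 * \<rho>)) + ennreal (2 * \<rho> * (s + 2 * \<rho>)))"
      unfolding S_def using \<rho> s by (intro sum_mono add_mono emeasure_slab_le) auto
    also have "\<dots> = ennreal (2 * (2 * \<rho> * (s + 2 * \<rho>) + 2 * \<rho> * (s + 2 * \<rho>)))"
      using \<rho> s by (subst ennreal_mult) (auto simp flip: ennreal_plus)
    also have "2 * (2 * \<rho> * (s + 2 * \<rho>) + 2 * \<rho> * (s + 2 * \<rho>)) = 8 * \<rho> * (s + 2 * \<rho>)"
      by simp
    finally show ?thesis .
  qed
  then have F': "measure lborel F \<le> 8 * \<rho> * (s + 2 * \<rho>)" "emeasure lborel F < \<infinity>"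
    using \<rho> s by (auto simp: measure_def intro!: enn2real_leI intro: le_less_trans)
  note sa = cell_avg_self_adjoint[OF \<rho> dI d1(3) g(1)]
  have i1: "integrable lborel (\<lambda>y. d y * g y)"
    using integrable_mult_bounded[OF g(1), of d 1] d1 by auto
  have i2: "integrable lborel (\<lambda>y. cell_avg \<rho> d y * g y)"
    using cell_avg_self_adjoint(2)[OF \<rho> g(1) g1 dI] by (simp add: mult.commute)
  have "(LINT y|lborel. indicator (box l u) y * (g y - cell_avg \<rho> g y)) = (LINT y|lborel. d y * g y - d y * cell_avg \<rho> g y)"
    by (simp add: d_def D_def algebra_simps)
  also have "\<dots> = (LINT y|lborel. d y * g y) - (LINT y|lborel. d y * cell_avg \<rho> g y)"
    using i1 sa(2) by (rule Bochner_Integration.integral_diff)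
  also have "\<dots> = (LINT y|lborel. d y * g y) - (LINT y|lborel. cell_avg \<rho> d y * g y)"
    using sa(1) by simp
  also have "\<dots> = (LINT y|lborel. (d y - cell_avg \<rho> d y) * g y)"
    using i1 i2 by (simp add: left_diff_distrib)
  also have "\<bar>\<dots>\<bar> \<le> (LINT y|lborel. \<bar>(d y - cell_avg \<rho> d y) * g y\<bar>)"
    by (rule integral_abs_bound)
  also have "\<dots> \<le> (LINT y|lborel. indicator F y)"
  proof (rule integral_mono)
    show "integrable lborel (\<lambda>y. \<bar>(d y - cell_avg \<rho> d y) * g y\<bar>)"
      using i1 i2 by (simp add: left_diff_distrib)
    show "integrable lborel (indicat_real F)" using F' by (intro integrable_real_indicator) auto
    show "\<bar>(d y - cell_avg \<rho> d y) * g y\<bar> \<le> indicator F y" for y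
      using mult_mono[OF diff g1, of y y] by (simp add: abs_mult)
  qed
  also have "\<dots> \<le> 8 * \<rho> * (s + 2 * \<rho>)" using F' by simp
  finally show ?thesis .
qed

section \<open>Autocorrelations averaged against an integrable density\<close>

definition autocorr :: "(real^2 \<Rightarrow> real) \<Rightarrow> real^2 \<Rightarrow> real" where
  "autocorr h t = (LINT x|lborel. h x * h (x + t))"

lemma integrable_translate:
  fixes f :: "'a::euclidean_space \<Rightarrow> real"
  assumes "integrable lborel f"
  shows "integrable lborel (\<lambda>x. f (x + t))" "(LINT x|lborel. f (x + t)) = (LINT x|lborel. f x)"
proof -
  have [measurable]: "f \<in> borel_measurable borel" using assms by (auto dest: borel_measurable_integrable)
  have "integrable (distr lborel borel ((+) t)) f" using assms by (simp add: lborel_distr_plus)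
  then show "integrable lborel (\<lambda>x. f (x + t))"
    by (subst (asm) integrable_distr_eq) (auto simp: add.commute)
  have "(LINT x|distr lborel borel ((+) t). f x) = (LINT x|lborel. f (t + x))"
    by (rule integral_distr) auto
  then show "(LINT x|lborel. f (x + t)) = (LINT x|lborel. f x)"
    by (simp add: lborel_distr_plus add.commute)
qed

lemma integral_affine:
  fixes f :: "'a::euclidean_space \<Rightarrow> real"
  assumes [measurable]: "f \<in> borel_measurable borel" and "c > 0"
  shows "(LINT x|lborel. f (t + c *\<^sub>R x)) = (LINT x|lborel. f x) / c ^ DIM('a)"
proof -
  have "(LINT x|lborel. f x) = (LINT x|density (distr lborel borel (\<lambda>x. t + c *\<^sub>R x)) (\<lambda>_. \<bar>c\<bar> ^ DIM('a)). f x)"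
    using assms(2) by (subst lborel_affine[of c t]) auto
  also have "\<dots> = (LINT x|lborel. c ^ DIM('a) * f (t + c *\<^sub>R x))"
    using assms(2) by (subst integral_density) (auto simp: integral_distr)
  finally show ?thesis using assms(2) by simp
qed

lemma borel_measurable_autocorr [measurable]:
  assumes [measurable]: "h \<in> borel_measurable borel"
  shows "autocorr h \<in> borel_measurable borel"
  unfolding autocorr_def by measurable

lemma abs_autocorr_le:
  assumes "integrable lborel h" "\<And>x. \<bar>h x\<bar> \<le> 1"
  shows "\<bar>autocorr h t\<bar> \<le> (LINT x|lborel. \<bar>h x\<bar>)"
proof -
  have [measurable]: "h \<in> borel_measurable borel" using assms by (auto dest: borel_measurable_integrable)
  have i: "integrable lborel (\<lambda>x. h (x + t) * h x)"
    by (rule integrable_mult_bounded[OF assms(1), where B=1]) (use assms(2) in auto)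
  have "\<bar>autocorr h t\<bar> \<le> (LINT x|lborel. \<bar>h (x + t) * h x\<bar>)"
    unfolding autocorr_def by (subst mult.commute) (rule integral_abs_bound)
  also have "\<dots> \<le> (LINT x|lborel. \<bar>h x\<bar>)"
    using assms by (intro integral_mono integrable_abs[OF i]) (auto simp: abs_mult mult_left_le_one_le)
  finally show ?thesis .
qed

lemma integrable_pair_product:
  fixes f :: "'a::euclidean_space \<Rightarrow> real" and g :: "'b::euclidean_space \<Rightarrow> real"
  assumes "integrable lborel f" "integrable lborel g"
  shows "integrable (lborel \<Otimes>\<^sub>M lborel) (\<lambda>(x, y). f x * g y)"
proof -
  have [measurable]: "f \<in> borel_measurable borel" "g \<in> borel_measurable borel"
    using assms by (auto dest: borel_measurable_integrable)
  show ?thesis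
    by (rule lborel_pair.Fubini_integrable) (use assms in \<open>auto simp: abs_mult\<close>)
qed

text \<open>For \<open>\<rho> > 0\<close> and integrable \<open>g\<close>, this is what the
  projection discards: it has mean zero on every cell.\<close>

definition detail :: "real \<Rightarrow> (real^2 \<Rightarrow> real) \<Rightarrow> real^2 \<Rightarrow> real" where
  "detail \<rho> g x = g x - cell_avg \<rho> g x"

lemma
  assumes "\<rho> > 0" "integrable lborel g" "\<And>x. 0 \<le> g x" "\<And>x. g x \<le> 1"
  shows integrable_detail: "integrable lborel (detail \<rho> g)"
    and abs_detail_le: "\<bar>detail \<rho> g x\<bar> \<le> 1"
    and integral_abs_detail_le: "(LINT x|lborel. \<bar>detail \<rho> g x\<bar>) \<le> 2 * (LINT x|lborel. g x)"
proof -
  note b = cell_avg_bounds[OF assms]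
  show i: "integrable lborel (detail \<rho> g)"
    unfolding detail_def[abs_def] using assms integrable_cell_avg by simp
  show "\<bar>detail \<rho> g x\<bar> \<le> 1" using b[of x] assms(3,4)[of x] by (simp add: detail_def)
  have "\<bar>detail \<rho> g x\<bar> \<le> g x + cell_avg \<rho> g x" for x
    using b[of x] assms(3,4)[of x] by (simp add: detail_def)
  then have "(LINT x|lborel. \<bar>detail \<rho> g x\<bar>) \<le> (LINT x|lborel. g x + cell_avg \<rho> g x)"
    using i assms integrable_cell_avg by (intro integral_mono) auto
  also have "\<dots> = 2 * (LINT x|lborel. g x)"
    using assms integrable_cell_avg integral_cell_avg by simp
  finally show "(LINT x|lborel. \<bar>detail \<rho> g x\<bar>) \<le> 2 * (LINT x|lborel. g x)" .
qed

text \<open>The constant \<open>c\<close> may depend on \<open>\<kappa>\<close> and \<open>\<eta>\<close> but not on \<open>g\<close>; this uniformity is what makes the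
  property stable under dominated limits of \<open>\<kappa>\<close>.\<close>

definition averages_detail :: "(real^2 \<Rightarrow> real) \<Rightarrow> bool" where
  "averages_detail \<kappa> \<longleftrightarrow> (\<forall>\<eta>>0. \<exists>c>0. \<forall>l>0. \<forall>\<rho>>0. \<rho> \<le> c * l \<longrightarrow>
    (\<forall>g. integrable lborel g \<longrightarrow> (\<forall>x. 0 \<le> g x \<and> g x \<le> 1) \<longrightarrow>
      \<bar>LINT t|lborel. \<kappa> t * autocorr (detail \<rho> g) (l *\<^sub>R t)\<bar> \<le> \<eta> * (LINT x|lborel. g x)))"

lemma averages_detailI:
  assumes "\<And>\<eta>. \<eta> > 0 \<Longrightarrow> \<exists>c>0. \<forall>l>0. \<forall>\<rho>>0. \<rho> \<le> c * l \<longrightarrow>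
    (\<forall>g. integrable lborel g \<longrightarrow> (\<forall>x. 0 \<le> g x \<and> g x \<le> 1) \<longrightarrow>
      \<bar>LINT t|lborel. \<kappa> t * autocorr (detail \<rho> g) (l *\<^sub>R t)\<bar> \<le> \<eta> * (LINT x|lborel. g x))"
  shows "averages_detail \<kappa>"
  unfolding averages_detail_def by (intro allI impI assms)

lemma averages_detailD:
  assumes "averages_detail \<kappa>" "\<eta> > 0"
  obtains c where "c > 0" "\<And>l \<rho> g. l > 0 \<Longrightarrow> \<rho> > 0 \<Longrightarrow> \<rho> \<le> c * l \<Longrightarrow> integrable lborel g \<Longrightarrow>
    (\<And>x. 0 \<le> g x) \<Longrightarrow> (\<And>x. g x \<le> 1) \<Longrightarrow>
      \<bar>LINT t|lborel. \<kappa> t * autocorr (detail \<rho> g) (l *\<^sub>R t)\<bar> \<le> \<eta> * (LINT x|lborel. g x)"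
proof -
  from assms(1)[unfolded averages_detail_def, rule_format, OF assms(2)]
  obtain c where c: "c > 0" "\<forall>l>0. \<forall>\<rho>>0. \<rho> \<le> c * l \<longrightarrow>
    (\<forall>g. integrable lborel g \<longrightarrow> (\<forall>x. 0 \<le> g x \<and> g x \<le> 1) \<longrightarrow>
      \<bar>LINT t|lborel. \<kappa> t * autocorr (detail \<rho> g) (l *\<^sub>R t)\<bar> \<le> \<eta> * (LINT x|lborel. g x))"
    by (elim exE conjE)
  show thesis
    by (rule that[OF c(1)], rule c(2)[rule_format]) simp_all
qed

text \<open>The autocorrelation of a detail is bounded by its \<open>L1\<close> norm. The resulting
  estimate is uniform in \<open>l\<close> and \<open>\<rho>\<close>, so approximating
  \<open>\<kappa>\<close> in \<open>L1\<close> approximates these integrals uniformly.\<close>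

lemma
  assumes \<kappa>: "integrable lborel \<kappa>" and "\<rho> > 0" "integrable lborel g" "\<And>x. 0 \<le> g x" "\<And>x. g x \<le> 1"
  shows integrable_mult_autocorr: "integrable lborel (\<lambda>t. \<kappa> t * autocorr (detail \<rho> g) (l *\<^sub>R t))"
    and abs_integral_mult_autocorr_le: "\<bar>LINT t|lborel. \<kappa> t * autocorr (detail \<rho> g) (l *\<^sub>R t)\<bar> \<le> (LINT t|lborel. \<bar>\<kappa> t\<bar>) * (2 * (LINT x|lborel. g x))"
proof -
  note d = integrable_detail[OF assms(2-)] abs_detail_le[OF assms(2-)] integral_abs_detail_le[OF assms(2-)]
  have [measurable]: "detail \<rho> g \<in> borel_measurable borel" "\<kappa> \<in> borel_measurable borel"
    using d(1) \<kappa> by (auto dest: borel_measurable_integrable)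
  have b: "\<bar>autocorr (detail \<rho> g) t\<bar> \<le> 2 * (LINT x|lborel. g x)" for t
    using abs_autocorr_le[OF d(1,2), of t] d(3) by linarith
  show i: "integrable lborel (\<lambda>t. \<kappa> t * autocorr (detail \<rho> g) (l *\<^sub>R t))"
    by (subst mult.commute, rule integrable_mult_bounded[OF \<kappa>]) (use b in auto)
  have "\<bar>LINT t|lborel. \<kappa> t * autocorr (detail \<rho> g) (l *\<^sub>R t)\<bar> \<le> (LINT t|lborel. \<bar>\<kappa> t * autocorr (detail \<rho> g) (l *\<^sub>R t)\<bar>)"
    by (rule integral_abs_bound)
  also have "\<dots> \<le> (LINT t|lborel. \<bar>\<kappa> t\<bar> * (2 * (LINT x|lborel. g x)))"
    using \<kappa> b by (intro integral_mono integrable_abs[OF i]) (auto simp: abs_mult intro!: mult_left_mono)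
  finally show "\<bar>LINT t|lborel. \<kappa> t * autocorr (detail \<rho> g) (l *\<^sub>R t)\<bar> \<le> (LINT t|lborel. \<bar>\<kappa> t\<bar>) * (2 * (LINT x|lborel. g x))"
    by simp
qed

section \<open>Stability under sums, multiples and dominated limits\<close>

lemma averages_detail_add:
  assumes "averages_detail \<kappa>" "averages_detail \<kappa>'" "integrable lborel \<kappa>" "integrable lborel \<kappa>'"
  shows "averages_detail (\<lambda>t. \<kappa> t + \<kappa>' t)"
proof (rule averages_detailI)
  fix \<eta> :: real assume "\<eta> > 0"
  then have \<eta>: "\<eta> / 2 > 0" by simp
  obtain c where c: "c > 0" "\<And>l \<rho> g. l > 0 \<Longrightarrow> \<rho> > 0 \<Longrightarrow> \<rho> \<le> c * l \<Longrightarrow> integrable lborel g \<Longrightarrow>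
    (\<And>x. 0 \<le> g x) \<Longrightarrow> (\<And>x. g x \<le> 1) \<Longrightarrow>
      \<bar>LINT t|lborel. \<kappa> t * autocorr (detail \<rho> g) (l *\<^sub>R t)\<bar> \<le> \<eta> / 2 * (LINT x|lborel. g x)"
    by (rule averages_detailD[OF assms(1) \<eta>]) blast
  obtain c' where c': "c' > 0" "\<And>l \<rho> g. l > 0 \<Longrightarrow> \<rho> > 0 \<Longrightarrow> \<rho> \<le> c' * l \<Longrightarrow> integrable lborel g \<Longrightarrow>
    (\<And>x. 0 \<le> g x) \<Longrightarrow> (\<And>x. g x \<le> 1) \<Longrightarrow>
      \<bar>LINT t|lborel. \<kappa>' t * autocorr (detail \<rho> g) (l *\<^sub>R t)\<bar> \<le> \<eta> / 2 * (LINT x|lborel. g x)"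
    by (rule averages_detailD[OF assms(2) \<eta>]) blast
  show "\<exists>c>0. \<forall>l>0. \<forall>\<rho>>0. \<rho> \<le> c * l \<longrightarrow>
    (\<forall>g. integrable lborel g \<longrightarrow> (\<forall>x. 0 \<le> g x \<and> g x \<le> 1) \<longrightarrow>
      \<bar>LINT t|lborel. (\<kappa> t + \<kappa>' t) * autocorr (detail \<rho> g) (l *\<^sub>R t)\<bar> \<le> \<eta> * (LINT x|lborel. g x))"
  proof (intro exI[of _ "min c c'"] conjI allI impI)
    fix l \<rho> :: real and g :: "real^2 \<Rightarrow> real"
    assume a: "l > 0" "\<rho> > 0" "\<rho> \<le> min c c' * l" "integrable lborel g" "\<forall>x. 0 \<le> g x \<and> g x \<le> 1"
    then have g: "\<And>x. 0 \<le> g x" "\<And>x. g x \<le> 1" by auto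
    have le: "\<rho> \<le> c * l" "\<rho> \<le> c' * l"
      using a by (auto intro: order_trans[OF _ mult_right_mono])
    have "(LINT t|lborel. (\<kappa> t + \<kappa>' t) * autocorr (detail \<rho> g) (l *\<^sub>R t)) =
      (LINT t|lborel. \<kappa> t * autocorr (detail \<rho> g) (l *\<^sub>R t)) + (LINT t|lborel. \<kappa>' t * autocorr (detail \<rho> g) (l *\<^sub>R t))"
      using integrable_mult_autocorr[OF assms(3) a(2,4) g] integrable_mult_autocorr[OF assms(4) a(2,4) g]
      by (simp add: distrib_right)
    then show "\<bar>LINT t|lborel. (\<kappa> t + \<kappa>' t) * autocorr (detail \<rho> g) (l *\<^sub>R t)\<bar> \<le> \<eta> * (LINT x|lborel. g x)"
      using c(2)[OF a(1,2) le(1) a(4) g] c'(2)[OF a(1,2) le(2) a(4) g] by (simp add: field_simps)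
  qed (use c c' in auto)
qed

lemma averages_detail_cmult:
  assumes "averages_detail \<kappa>"
  shows "averages_detail (\<lambda>t. a * \<kappa> t)"
proof (rule averages_detailI)
  fix \<eta> :: real assume \<eta>: "\<eta> > 0"
  \<comment> \<open>Adding one to \<open>\<bar>a\<bar>\<close> covers the case
    \<open>a = 0\<close>.\<close>
  then have "\<eta> / (\<bar>a\<bar> + 1) > 0" by simp
  from averages_detailD[OF assms this]
  obtain c where c: "c > 0" "\<And>l \<rho> g. l > 0 \<Longrightarrow> \<rho> > 0 \<Longrightarrow> \<rho> \<le> c * l \<Longrightarrow> integrable lborel g \<Longrightarrow>
    (\<And>x. 0 \<le> g x) \<Longrightarrow> (\<And>x. g x \<le> 1) \<Longrightarrow>
      \<bar>LINT t|lborel. \<kappa> t * autocorr (detail \<rho> g) (l *\<^sub>R t)\<bar> \<le> \<eta> / (\<bar>a\<bar> + 1) * (LINT x|lborel. g x)"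
    by blast
  show "\<exists>c>0. \<forall>l>0. \<forall>\<rho>>0. \<rho> \<le> c * l \<longrightarrow>
    (\<forall>g. integrable lborel g \<longrightarrow> (\<forall>x. 0 \<le> g x \<and> g x \<le> 1) \<longrightarrow>
      \<bar>LINT t|lborel. (a * \<kappa> t) * autocorr (detail \<rho> g) (l *\<^sub>R t)\<bar> \<le> \<eta> * (LINT x|lborel. g x))"
  proof (intro exI[of _ c] conjI allI impI)
    fix l \<rho> :: real and g :: "real^2 \<Rightarrow> real"
    assume b: "l > 0" "\<rho> > 0" "\<rho> \<le> c * l" "integrable lborel g" "\<forall>x. 0 \<le> g x \<and> g x \<le> 1"
    then have g: "\<And>x. 0 \<le> g x" "\<And>x. g x \<le> 1" by auto
    have "0 \<le> (LINT x|lborel. g x)" using g by simp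
    then have "\<bar>a\<bar> * \<eta> * (LINT x|lborel. g x) \<le> (\<bar>a\<bar> + 1) * \<eta> * (LINT x|lborel. g x)"
      using \<eta> by (intro mult_right_mono) auto
    then have "\<bar>a\<bar> * (\<eta> / (\<bar>a\<bar> + 1) * (LINT x|lborel. g x)) \<le> \<eta> * (LINT x|lborel. g x)"
      by (simp add: field_simps)
    moreover have "\<bar>a\<bar> * \<bar>LINT t|lborel. \<kappa> t * autocorr (detail \<rho> g) (l *\<^sub>R t)\<bar> \<le> \<bar>a\<bar> * (\<eta> / (\<bar>a\<bar> + 1) * (LINT x|lborel. g x))"
      by (rule mult_left_mono[OF c(2)[OF b(1-4) g]]) auto
    ultimately show "\<bar>LINT t|lborel. (a * \<kappa> t) * autocorr (detail \<rho> g) (l *\<^sub>R t)\<bar> \<le> \<eta> * (LINT x|lborel. g x)"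
      by (simp add: mult.assoc abs_mult)
  qed (use c in auto)
qed

text \<open>Dominated convergence makes \<open>K n\<close> converge to \<open>\<kappa>\<close> in
  \<open>L1\<close>. A single late \<open>n\<close> then serves all \<open>l\<close>,
  \<open>\<rho>\<close> and \<open>g\<close> at once, and \<open>\<kappa>\<close> inherits its
  constant \<open>c\<close>.\<close>

lemma averages_detail_lim:
  assumes good: "\<And>n::nat. averages_detail (K n)" and K: "\<And>n. integrable lborel (K n)"
    and lim: "\<And>t. (\<lambda>n. K n t) \<longlonglongrightarrow> \<kappa> t" and w: "integrable lborel w" "\<And>n t. \<bar>K n t\<bar> \<le> w t"
  shows "averages_detail \<kappa>" "integrable lborel \<kappa>"
proof -
  have [measurable]: "K n \<in> borel_measurable borel" for n
    using K by (auto dest: borel_measurable_integrable)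
  have [measurable]: "\<kappa> \<in> borel_measurable borel"
    by (rule borel_measurable_LIMSEQ_real[OF lim]) auto
  have \<kappa>w: "\<bar>\<kappa> t\<bar> \<le> w t" for t
    using lim[of t] w(2)[of _ t] by (intro Lim_bounded[OF tendsto_rabs[OF lim]]) auto
  show \<kappa>: "integrable lborel \<kappa>"
    by (rule Bochner_Integration.integrable_bound[OF w(1)]) (auto intro!: AE_I2 order_trans[OF \<kappa>w])
  have conv: "(\<lambda>n. LINT t|lborel. \<bar>K n t - \<kappa> t\<bar>) \<longlonglongrightarrow> (LINT t|(lborel :: (real^2) measure). (0::real))"
  proof (rule integral_dominated_convergence[where w="\<lambda>t. 2 * w t"])
    show "AE t in lborel. (\<lambda>n. \<bar>K n t - \<kappa> t\<bar>) \<longlonglongrightarrow> 0"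
      using lim by (intro AE_I2 tendsto_rabs_zero) (simp add: LIM_zero)
    show "AE t in lborel. norm \<bar>K n t - \<kappa> t\<bar> \<le> 2 * w t" for n
    proof (intro AE_I2)
      fix t show "norm \<bar>K n t - \<kappa> t\<bar> \<le> 2 * w t" using w(2)[of n t] \<kappa>w[of t] by simp
    qed
  qed (use w in auto)
  show "averages_detail \<kappa>"
  proof (rule averages_detailI)
    fix \<eta> :: real assume \<eta>: "\<eta> > 0"
    \<comment> \<open>Half of \<open>\<eta>\<close> is spent on \<open>K n\<close>. The error of
      replacing \<open>\<kappa>\<close> costs the other half, since a factor 2 comes from the
      \<open>L1\<close> norm of the detail.\<close>
    then have "\<forall>\<^sub>F n in sequentially. (LINT t|lborel. \<bar>K n t - \<kappa> t\<bar>) < \<eta> / 4"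
      using conv by (intro order_tendstoD(2)[OF conv]) auto
    then obtain n where n: "(LINT t|lborel. \<bar>K n t - \<kappa> t\<bar>) < \<eta> / 4"
      by (auto simp: eventually_sequentially)
    have "\<eta> / 2 > 0" using \<eta> by simp
    from averages_detailD[OF good[of n] this]
    obtain c where c: "c > 0" "\<And>l \<rho> g. l > 0 \<Longrightarrow> \<rho> > 0 \<Longrightarrow> \<rho> \<le> c * l \<Longrightarrow> integrable lborel g \<Longrightarrow>
      (\<And>x. 0 \<le> g x) \<Longrightarrow> (\<And>x. g x \<le> 1) \<Longrightarrow>
        \<bar>LINT t|lborel. K n t * autocorr (detail \<rho> g) (l *\<^sub>R t)\<bar> \<le> \<eta> / 2 * (LINT x|lborel. g x)"
      by blast
    show "\<exists>c>0. \<forall>l>0. \<forall>\<rho>>0. \<rho> \<le> c * l \<longrightarrow>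
      (\<forall>g. integrable lborel g \<longrightarrow> (\<forall>x. 0 \<le> g x \<and> g x \<le> 1) \<longrightarrow>
        \<bar>LINT t|lborel. \<kappa> t * autocorr (detail \<rho> g) (l *\<^sub>R t)\<bar> \<le> \<eta> * (LINT x|lborel. g x))"
    proof (intro exI[of _ c] conjI allI impI)
      fix l \<rho> :: real and g :: "real^2 \<Rightarrow> real"
      assume b: "l > 0" "\<rho> > 0" "\<rho> \<le> c * l" "integrable lborel g" "\<forall>x. 0 \<le> g x \<and> g x \<le> 1"
      then have g: "\<And>x. 0 \<le> g x" "\<And>x. g x \<le> 1" by auto
      have i: "integrable lborel (\<lambda>t. K n t - \<kappa> t)" using K \<kappa> by simp
      have "(LINT t|lborel. \<kappa> t * autocorr (detail \<rho> g) (l *\<^sub>R t)) = (LINT t|lborel. K n t * autocorr (detail \<rho> g) (l *\<^sub>R t))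
         - (LINT t|lborel. (K n t - \<kappa> t) * autocorr (detail \<rho> g) (l *\<^sub>R t))"
        using integrable_mult_autocorr[OF K b(2,4) g] integrable_mult_autocorr[OF \<kappa> b(2,4) g]
        by (simp add: left_diff_distrib)
      moreover have "\<bar>LINT t|lborel. (K n t - \<kappa> t) * autocorr (detail \<rho> g) (l *\<^sub>R t)\<bar> \<le> (LINT t|lborel. \<bar>K n t - \<kappa> t\<bar>) * (2 * (LINT x|lborel. g x))"
        by (rule abs_integral_mult_autocorr_le[OF i b(2,4) g])
      moreover have "\<dots> \<le> \<eta> / 4 * (2 * (LINT x|lborel. g x))"
        using n g by (intro mult_right_mono) auto
      ultimately show "\<bar>LINT t|lborel. \<kappa> t * autocorr (detail \<rho> g) (l *\<^sub>R t)\<bar> \<le> \<eta> * (LINT x|lborel. g x)"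
        using c(2)[OF b(1-4) g] by linarith
    qed (use c in auto)
  qed
qed

section \<open>From indicators of boxes to all integrable kernels\<close>

lemma averages_detail_box: "averages_detail (indicator (box a b))"
proof (rule averages_detailI)
  fix \<eta> :: real assume \<eta>: "\<eta> > 0"
  define s where "s = \<bar>b $ 1 - a $ 1\<bar> + \<bar>b $ 2 - a $ 2\<bar>"
  have s: "s \<ge> 0" "b $ i - a $ i \<le> s" for i
    using exhaust_2[of i] by (auto simp: s_def)
  \<comment> \<open>The final bound has the factor \<open>16 * c * (s + 2 * c)\<close>, with 8 from
    the boundary layer and 2 from the \<open>L1\<close> norm of the detail. The cap 1 allows
    \<open>s + 2 * c\<close> to be replaced by \<open>s + 2\<close>.\<close>
  define c where "c = min 1 (\<eta> / (16 * (s + 2)))"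
  have c: "c > 0" "c \<le> 1" using \<eta> s(1) by (auto simp: c_def)
  have "16 * c * (s + 2) = c * (16 * (s + 2))" by simp
  also have "\<dots> \<le> \<eta> / (16 * (s + 2)) * (16 * (s + 2))"
    using s(1) by (intro mult_right_mono) (auto simp: c_def)
  also have "\<dots> = \<eta>" using s(1) by simp
  finally have c3: "16 * c * (s + 2) \<le> \<eta>" .
  show "\<exists>c>0. \<forall>l>0. \<forall>\<rho>>0. \<rho> \<le> c * l \<longrightarrow>
    (\<forall>g. integrable lborel g \<longrightarrow> (\<forall>x. 0 \<le> g x \<and> g x \<le> 1) \<longrightarrow>
      \<bar>LINT t|lborel. indicator (box a b) t * autocorr (detail \<rho> g) (l *\<^sub>R t)\<bar> \<le> \<eta> * (LINT x|lborel. g x))"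
  proof (intro exI[of _ c] conjI allI impI)
    fix l \<rho> :: real and g :: "real^2 \<Rightarrow> real"
    assume A: "l > 0" "\<rho> > 0" "\<rho> \<le> c * l" "integrable lborel g" "\<forall>x. 0 \<le> g x \<and> g x \<le> 1"
    then have g: "\<And>x. 0 \<le> g x" "\<And>x. g x \<le> 1" by auto
    define h where "h = detail \<rho> g"
    note h = integrable_detail[OF A(2,4) g, folded h_def] abs_detail_le[OF A(2,4) g, folded h_def]
      integral_abs_detail_le[OF A(2,4) g, folded h_def]
    have [measurable]: "h \<in> borel_measurable borel" using h(1) by (auto dest: borel_measurable_integrable)
    \<comment> \<open>With the integral over \<open>t\<close> taken first, \<open>J x\<close> is a
      rescaled integral of the detail over a box of size comparable to \<open>l\<close>. Whole cells
      cancel there, so only a boundary layer of relative width about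
      \<open>\<rho> / l \<le> c\<close> contributes.\<close>
    define J where "J = (\<lambda>x. LINT t|lborel. indicator (box a b) t * h (x + l *\<^sub>R t))"
    have J: "\<bar>J x\<bar> \<le> 8 * c * (s + 2 * c)" for x
    proof -
      let ?D = "box (x + l *\<^sub>R a) (x + l *\<^sub>R b)"
      have "J x = (LINT t|lborel. indicator ?D (x + l *\<^sub>R t) * h (x + l *\<^sub>R t))"
        unfolding J_def using A(1)
        by (intro Bochner_Integration.integral_cong) (auto simp: indicator_def mem_box_cart)
      also have "\<dots> = (LINT y|lborel. indicator ?D y * h y) / l\<^sup>2"
        using integral_affine[of "\<lambda>y. indicator ?D y * h y" l x] A(1) by simp
      also have "\<bar>\<dots>\<bar> \<le> 8 * \<rho> * (l * s + 2 * \<rho>) / l\<^sup>2"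
      proof -
        have "\<bar>LINT y|lborel. indicator ?D y * h y\<bar> \<le> 8 * \<rho> * (l * s + 2 * \<rho>)"
          unfolding h_def detail_def
        proof (rule box_boundary_integral_le[OF A(2,4) g])
          show "0 \<le> l * s" using A s by simp
          show "(x + l *\<^sub>R b) $ i - (x + l *\<^sub>R a) $ i \<le> l * s" for i
            using mult_left_mono[OF s(2)[of i], of l] A(1) by (simp add: right_diff_distrib)
        qed
        then show ?thesis by (simp add: divide_right_mono)
      qed
      also have "\<dots> \<le> 8 * (c * l) * (l * s + 2 * (c * l)) / l\<^sup>2"
        using A s c by (intro divide_right_mono mult_mono add_mono) auto
      also have "\<dots> = 8 * c * (s + 2 * c)" using A(1) by (simp add: power2_eq_square field_simps)
      finally show ?thesis .
    qed
    have ind: "integrable lborel (indicat_real (box a b))"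
      using emeasure_lborel_box_finite[of a b] by (intro integrable_real_indicator) auto
    have int: "integrable (lborel \<Otimes>\<^sub>M lborel) (\<lambda>(t, x). indicator (box a b) t * (h x * h (x + l *\<^sub>R t)))"
    proof (rule Bochner_Integration.integrable_bound[OF integrable_pair_product[OF ind h(1)]])
      show "AE p in lborel \<Otimes>\<^sub>M lborel. norm (case p of (t, x) \<Rightarrow> indicator (box a b) t * (h x * h (x + l *\<^sub>R t)))
         \<le> norm (case p of (t, x) \<Rightarrow> indicator (box a b) t * h x)"
        using h(2) by (intro AE_I2) (auto simp: abs_mult mult_left_le split: split_indicator)
    qed measurable
    have "(LINT t|lborel. indicator (box a b) t * autocorr h (l *\<^sub>R t)) =
      (LINT t|lborel. LINT x|lborel. indicator (box a b) t * (h x * h (x + l *\<^sub>R t)))"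
      by (simp add: autocorr_def)
    also have "\<dots> = (LINT x|lborel. LINT t|lborel. indicator (box a b) t * (h x * h (x + l *\<^sub>R t)))"
      using lborel_pair.Fubini_integral[OF int] by simp
    also have "\<dots> = (LINT x|lborel. J x * h x)"
      unfolding J_def integral_mult_left_zero[symmetric]
      by (intro Bochner_Integration.integral_cong) (auto simp: mult_ac)
    also have "\<bar>\<dots>\<bar> \<le> (LINT x|lborel. \<bar>J x * h x\<bar>)" by (rule integral_abs_bound)
    also have "\<dots> \<le> (LINT x|lborel. (8 * c * (s + 2 * c)) * \<bar>h x\<bar>)"
    proof (rule integral_mono)
      have [measurable]: "J \<in> borel_measurable borel" unfolding J_def by measurable
      show "integrable lborel (\<lambda>x. \<bar>J x * h x\<bar>)"
        by (intro integrable_abs integrable_mult_bounded[OF h(1) _ J]) simp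
      show "\<bar>J x * h x\<bar> \<le> (8 * c * (s + 2 * c)) * \<bar>h x\<bar>" for x
        using J[of x] by (simp add: abs_mult mult_right_mono)
    qed (use h in auto)
    also have "\<dots> \<le> (8 * c * (s + 2 * c)) * (2 * (LINT x|lborel. g x))"
      using h(3) c s by (simp add: mult_left_mono del: mult_le_cancel_left_pos)
    also have "\<dots> = (16 * c * (s + 2 * c)) * (LINT x|lborel. g x)" by simp
    also have "\<dots> \<le> \<eta> * (LINT x|lborel. g x)"
    proof (rule mult_right_mono)
      have "16 * c * (s + 2 * c) \<le> 16 * c * (s + 2)" using c s by (intro mult_left_mono) auto
      then show "16 * c * (s + 2 * c) \<le> \<eta>" using c3 by linarith
    qed (use g in simp)
    finally show "\<bar>LINT t|lborel. indicator (box a b) t * autocorr (detail \<rho> g) (l *\<^sub>R t)\<bar> \<le> \<eta> * (LINT x|lborel. g x)"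
      by (simp add: h_def)
  qed (use c in auto)
qed

text \<open>Dynkin's theorem, with the intersection-stable generator of open boxes. Intersecting
  with a fixed box keeps all indicators integrable, including those of complements.\<close>

lemma averages_detail_indicator_Int_box:
  assumes "A \<in> sets borel"
  shows "averages_detail (indicator (A \<inter> box a b))"
proof -
  have fin: "integrable lborel (indicat_real (A \<inter> box a b))" if "A \<in> sets borel" for A
    using that emeasure_lborel_box_finite[of a b] emeasure_mono[of "A \<inter> box a b" "box a b" lborel]
    by (intro integrable_real_indicator) (auto simp: less_top intro: le_less_trans)
  have "Int_stable (range (\<lambda>(a, b). box a b :: (real^2) set))"
    by (auto simp: Int_stable_def box_Int_box)
  moreover have "range (\<lambda>(a, b). box a b :: (real^2) set) \<subseteq> Pow UNIV" by simp
  moreover have "A \<in> sigma_sets UNIV (range (\<lambda>(a, b). box a b :: (real^2) set))"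
    using assms by (simp add: borel_eq_box)
  ultimately show ?thesis
  proof (induction rule: sigma_sets_induct_disjoint)
    case (basic A)
    then show ?case by (auto simp: box_Int_box intro: averages_detail_box)
  next
    case empty
    \<comment> \<open>The zero function is 0 times the indicator of a box.\<close>
    then show ?case using averages_detail_cmult[OF averages_detail_box, of 0] by simp
  next
    case (compl A)
    then have A: "A \<in> sets borel" by (simp add: borel_eq_box)
    have "(indicat_real ((UNIV - A) \<inter> box a b)) = (\<lambda>t. indicator (box a b) t + (- 1) * indicator (A \<inter> box a b) t)"
      by (auto simp: indicator_def)
    then show ?case
      using averages_detail_add[OF averages_detail_box averages_detail_cmult[OF compl(2), of "-1"]] fin[OF A] fin[of UNIV]
      by simp
  next
    case (union F)
    then have F: "F i \<in> sets borel" for i by (auto simp: borel_eq_box)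
    \<comment> \<open>Additivity gives finite disjoint unions. These increase to the full union and
      are dominated by the indicator of the fixed box.\<close>
    have part: "averages_detail (indicator ((\<Union>i<n. F i) \<inter> box a b))" for n
    proof (induction n)
      case 0
      then show ?case using averages_detail_cmult[OF averages_detail_box, of 0] by simp
    next
      case (Suc n)
      have "F i \<inter> F n = {}" if "i < n" for i
        using union(1) that by (simp add: disjoint_family_on_def)
      then have "(\<Union>i<n. F i) \<inter> F n = {}" by blast
      then have "indicat_real ((\<Union>i<Suc n. F i) \<inter> box a b) = (\<lambda>t. indicator ((\<Union>i<n. F i) \<inter> box a b) t + indicator (F n \<inter> box a b) t)"
        by (auto simp: indicator_def less_Suc_eq fun_eq_iff)
      then show ?case
        using averages_detail_add[OF Suc.IH union(3)[of n] fin fin] F by auto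
    qed
    show ?case
    proof (rule averages_detail_lim(1)[OF part])
      show "integrable lborel (indicat_real ((\<Union>i<n. F i) \<inter> box a b))" for n using F by (intro fin) auto
      show "(\<lambda>n. indicat_real ((\<Union>i<n. F i) \<inter> box a b) t) \<longlonglongrightarrow> indicat_real (\<Union> (range F) \<inter> box a b) t" for t
        using LIMSEQ_indicator_UN[of F t] by (auto simp: indicator_inter_arith intro!: tendsto_intros)
      show "integrable lborel (indicat_real (UNIV \<inter> box a b))" by (intro fin) auto
    qed (auto simp: indicator_def)
  qed
qed

text \<open>Sets of finite measure are exhausted by their intersections with growing boxes; sums and
  dominated limits then reach every integrable function.\<close>

lemma averages_detail_integrable:
  assumes "integrable lborel \<kappa>"
  shows "averages_detail \<kappa>"
  using assms
proof (induction rule: integrable_induct)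
  case (base A c)
  define B where "B = (\<lambda>n::nat. box (\<chi> i. - real n) (\<chi> i. real n) :: (real^2) set)"
  have A: "A \<in> sets borel" "integrable lborel (indicat_real A)" using base by auto
  have "averages_detail (indicator A)"
  proof (rule averages_detail_lim(1))
    show "averages_detail (indicator (A \<inter> B n))" for n
      unfolding B_def using A by (intro averages_detail_indicator_Int_box)
    show "integrable lborel (indicat_real (A \<inter> B n))" for n
      using A by (intro Bochner_Integration.integrable_bound[OF A(2)]) (auto simp: B_def indicator_def)
    show "(\<lambda>n. indicat_real (A \<inter> B n) t) \<longlonglongrightarrow> indicat_real A t" for t
    proof -
      obtain m :: nat where m: "norm t < m" using reals_Archimedean2 by blast
      have "t \<in> B n" if "n \<ge> m" for n
        unfolding B_def mem_box_cart
      proof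
        fix i
        have "\<bar>t $ i\<bar> < n" using component_le_norm_cart[of t i] m that by linarith
        then show "(\<chi> i. - real n) $ i < t $ i \<and> t $ i < (\<chi> i. real n) $ i" by (simp add: abs_less_iff)
      qed
      then have "\<forall>\<^sub>F n in sequentially. indicat_real (A \<inter> B n) t = indicat_real A t"
        by (auto simp: eventually_sequentially indicator_def)
      then show ?thesis by (rule tendsto_eventually)
    qed
  qed (use A in \<open>auto simp: indicator_def\<close>)
  from averages_detail_cmult[OF this, of c] show ?case by (simp add: mult.commute)
next
  case (add f g)
  then show ?case by (intro averages_detail_add)
next
  case (lim f s)
  show ?case
    by (rule averages_detail_lim(1)[of s, where w="\<lambda>t. 2 * \<bar>f t\<bar>"]) (use lim in auto)
qed

section \<open>Averages over a circular arc\<close>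

definition circ :: "real \<Rightarrow> real^2" where
  "circ u = cos u *\<^sub>R axis 1 1 + sin u *\<^sub>R axis 2 1"

lemma circ_nth [simp]: "circ u $ 1 = cos u" "circ u $ 2 = sin u"
  by (auto simp: circ_def axis_def)

lemma norm_circ [simp]: "norm (circ u) = 1"
  by (simp add: norm_vec_def L2_set_def UNIV_2)

lemma borel_measurable_circ [measurable]: "circ \<in> borel_measurable borel"
  unfolding circ_def by measurable

text \<open>Angles range over one radian instead of the full circle. The total mass is one, and two
  angles differ by less than \<open>\<pi>\<close>, which excludes antipodal pairs, where the chord
  map is also singular.\<close>

definition arc_measure :: "real measure" where
  "arc_measure = density lborel (indicator {0..1})"

lemma sets_arc_measure [simp, measurable_cong]: "sets arc_measure = sets borel"
  and space_arc_measure [simp]: "space arc_measure = UNIV"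
  by (simp_all add: arc_measure_def)

lemma emeasure_arc_measure_UNIV: "emeasure arc_measure UNIV = 1"
  by (simp add: arc_measure_def emeasure_density)

interpretation arc_measure: finite_measure arc_measure
  by standard (simp add: emeasure_arc_measure_UNIV)

interpretation arc_measure_pair: pair_sigma_finite arc_measure arc_measure ..

lemma measure_arc_measure_UNIV [simp]: "measure arc_measure UNIV = 1"
  by (simp add: measure_def emeasure_arc_measure_UNIV)

text \<open>The chord map \<open>(u, v) \<mapsto> circ v - circ u\<close> has Jacobian determinant \<open>\<plusminus> sin (v - u)\<close>, which on the unit square
  vanishes only on the diagonal.\<close>

lemma negligible_chord_vimage:
  assumes "negligible N"
  shows "negligible {p \<in> {0..1} \<times> {0..1}. circ (snd p) - circ (fst p) \<in> N}"
proof -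
  define \<Psi> :: "real^2 \<Rightarrow> real^2" where "\<Psi> = (\<lambda>q. circ (q $ 2) - circ (q $ 1))"
  define \<Psi>' :: "real^2 \<Rightarrow> real^2 \<Rightarrow> real^2" where
    "\<Psi>' = (\<lambda>q v. (- sin (q $ 2) * v $ 2 + sin (q $ 1) * v $ 1) *\<^sub>R axis 1 1 + (cos (q $ 2) * v $ 2 - cos (q $ 1) * v $ 1) *\<^sub>R axis 2 1)"
  \<comment> \<open>The diagonal, where the derivative is singular, is left out here. It lies on a
    line and is added back as a null set.\<close>
  define S where "S = {q::real^2. q $ 1 \<in> {0..1} \<and> q $ 2 \<in> {0..1} \<and> q $ 1 \<noteq> q $ 2}"
  have "negligible {q \<in> S. \<Psi> q \<in> N}"
  proof (rule negligible_differentiable_vimage[OF assms])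
    fix q assume q: "q \<in> S"
    have nth: "((\<lambda>q::real^2. q $ i) has_derivative (\<lambda>v. v $ i)) (at q within S)" for i
      by (rule bounded_linear.has_derivative[OF bounded_linear_vec_nth has_derivative_ident])
    show "(\<Psi> has_derivative \<Psi>' q) (at q within S)"
      unfolding \<Psi>_def \<Psi>'_def circ_def
      by (rule derivative_eq_intros nth refl)+ (auto simp: fun_eq_iff algebra_simps)
    have D: "sin (q $ 2 - q $ 1) \<noteq> 0"
    proof -
      have "\<bar>q $ 2 - q $ 1\<bar> < pi" "q $ 2 - q $ 1 \<noteq> 0"
        using q pi_gt3 by (auto simp: S_def)
      then show ?thesis using sin_gt_zero[of "q $ 2 - q $ 1"] sin_gt_zero[of "- (q $ 2 - q $ 1)"] sin_minus[of "q $ 2 - q $ 1"]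
        by (cases "q $ 2 - q $ 1 > 0") auto
    qed
    have lin: "linear (\<Psi>' q)"
      unfolding \<Psi>'_def by (rule linearI) (auto simp: algebra_simps)
    have "v = 0" if "\<Psi>' q v = 0" for v
    proof -
      have 1: "- sin (q $ 2) * v $ 2 + sin (q $ 1) * v $ 1 = 0" and 2: "cos (q $ 2) * v $ 2 - cos (q $ 1) * v $ 1 = 0"
        using arg_cong[OF that, of "\<lambda>w. w $ 1"] arg_cong[OF that, of "\<lambda>w. w $ 2"]
        by (simp_all add: \<Psi>'_def axis_def)
      \<comment> \<open>Cramer's rule: this combination of equations \<open>1\<close> and
        \<open>2\<close> eliminates \<open>v $ 2\<close>, and the analogous one below eliminates
        \<open>v $ 1\<close>. The determinant is the sine in \<open>D\<close> up to sign.\<close>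
      have "- (sin (q $ 2 - q $ 1) * v $ 1) = cos (q $ 2) * (- sin (q $ 2) * v $ 2 + sin (q $ 1) * v $ 1)
         + sin (q $ 2) * (cos (q $ 2) * v $ 2 - cos (q $ 1) * v $ 1)"
        by (simp add: sin_diff algebra_simps)
      then have "v $ 1 = 0" unfolding 1 2 using D by simp
      have "- (sin (q $ 2 - q $ 1) * v $ 2) = cos (q $ 1) * (- sin (q $ 2) * v $ 2 + sin (q $ 1) * v $ 1)
         + sin (q $ 1) * (cos (q $ 2) * v $ 2 - cos (q $ 1) * v $ 1)"
        by (simp add: sin_diff algebra_simps)
      then have "v $ 2 = 0" unfolding 1 2 using D by simp
      with \<open>v $ 1 = 0\<close> show ?thesis by (simp add: vec_eq_iff forall_2)
    qed
    then show "inj (\<Psi>' q)" using lin by (simp add: linear_injective_0)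
  qed
  moreover have "negligible {q::real^2. (axis 1 1 - axis 2 1) \<bullet> q = 0}"
  proof (rule negligible_hyperplane)
    have "(axis 1 1 - axis 2 1 :: real^2) $ 1 \<noteq> 0" by (simp add: axis_def)
    then show "(axis 1 1 - axis 2 1 :: real^2) \<noteq> 0 \<or> (0::real) \<noteq> 0" by (metis zero_index)
  qed
  ultimately have "negligible ({q \<in> S. \<Psi> q \<in> N} \<union> {q. (axis 1 1 - axis 2 1) \<bullet> q = 0})"
    by (rule negligible_Un)
  \<comment> \<open>The derivative argument lives in \<open>real^2\<close>; the linear coordinate
    map carries the null set over to pairs of reals.\<close>
  then have "negligible ((\<lambda>q. (q $ 1, q $ 2)) ` ({q \<in> S. \<Psi> q \<in> N} \<union> {q. (axis 1 1 - axis 2 1) \<bullet> q = 0}))"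
  proof (rule negligible_differentiable_image_negligible[rotated])
    have "linear (\<lambda>q::real^2. (q $ 1, q $ 2))" by (rule linearI) auto
    then show "(\<lambda>q::real^2. (q $ 1, q $ 2)) differentiable_on T" for T
      by (rule linear_imp_differentiable_on)
  qed auto
  then show ?thesis
  proof (rule negligible_subset, intro subsetI)
    fix p assume p: "p \<in> {p \<in> {0..1} \<times> {0..1}. circ (snd p) - circ (fst p) \<in> N}"
    define q :: "real^2" where "q = vector [fst p, snd p]"
    have q: "q $ 1 = fst p" "q $ 2 = snd p" by (simp_all add: q_def)
    have "q \<in> {q \<in> S. \<Psi> q \<in> N} \<union> {q. (axis 1 1 - axis 2 1) \<bullet> q = 0}"
      using p by (auto simp: S_def \<Psi>_def q inner_diff_left inner_axis')
    moreover have "p = (q $ 1, q $ 2)" by (simp add: q)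
    ultimately show "p \<in> (\<lambda>q. (q $ 1, q $ 2)) ` ({q \<in> S. \<Psi> q \<in> N} \<union> {q. (axis 1 1 - axis 2 1) \<bullet> q = 0})"
      by blast
  qed
qed

section \<open>The law of a random chord\<close>

lemma arc_measure_pair_eq: "arc_measure \<Otimes>\<^sub>M arc_measure = density lborel (indicator ({0..1} \<times> {0..1}))"
proof -
  have "arc_measure \<Otimes>\<^sub>M arc_measure = density (lborel \<Otimes>\<^sub>M lborel) (\<lambda>(x, y). indicator {0..1} x * indicator {0..1} y)"
    unfolding arc_measure_def
    by (rule pair_measure_density) (use arc_measure.sigma_finite_measure_axioms in \<open>auto simp: arc_measure_def sigma_finite_lborel\<close>)
  also have "\<dots> = density lborel (indicator ({0..1} \<times> {0..1}))"
    unfolding lborel_prod by (intro arg_cong2[where f=density] refl) (auto simp: fun_eq_iff indicator_def)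
  finally show ?thesis .
qed

text \<open>Preimages of null sets under the chord map are null, so the chord between two
  independent uniform points of the arc has an absolutely continuous law. Its Radon-Nikodym density
  is \<open>\<kappa>\<close>.\<close>

lemma chord_density:
  obtains \<kappa> :: "real^2 \<Rightarrow> real" where "integrable lborel \<kappa>"
    "\<And>F :: real^2 \<Rightarrow> real. F \<in> borel_measurable borel \<Longrightarrow>
      (LINT p|(arc_measure \<Otimes>\<^sub>M arc_measure). F (circ (snd p) - circ (fst p))) = (LINT t|lborel. \<kappa> t * F t)"
proof -
  define \<Phi> where "\<Phi> = (\<lambda>p. circ (snd p) - circ (fst p))"
  have \<Phi>[measurable]: "\<Phi> \<in> arc_measure \<Otimes>\<^sub>M arc_measure \<rightarrow>\<^sub>M borel" unfolding \<Phi>_def by measurable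
  define N where "N = distr (arc_measure \<Otimes>\<^sub>M arc_measure) lborel \<Phi>"
  have "absolutely_continuous lborel N"
    unfolding absolutely_continuous_def
  proof
    fix A :: "(real^2) set" assume A: "A \<in> null_sets lborel"
    then have [measurable]: "A \<in> sets borel" by auto
    have "negligible A" using A by (simp add: negligible_iff_null_sets null_sets_completionI)
    from negligible_chord_vimage[OF this]
    have "AE p in lebesgue. p \<notin> {p \<in> {0..1} \<times> {0..1}. \<Phi> p \<in> A}"
      unfolding negligible_iff_null_sets \<Phi>_def by (rule AE_not_in)
    then have "AE p in lborel. p \<notin> {p \<in> {0..1} \<times> {0..1}. \<Phi> p \<in> A}"
      by (simp add: AE_completion_iff)
    then have "AE p in lborel. p \<in> \<Phi> -` A \<longrightarrow> (indicator ({0..1} \<times> {0..1}) p :: ennreal) = 0"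
      by eventually_elim (auto simp: indicator_def)
    moreover have "\<Phi> -` A \<in> sets borel"
      using measurable_sets[OF \<Phi>, of A] by (simp add: space_pair_measure borel_prod[symmetric] cong: sets_pair_measure_cong)
    ultimately have "\<Phi> -` A \<in> null_sets (arc_measure \<Otimes>\<^sub>M arc_measure)"
      unfolding arc_measure_pair_eq by (subst null_sets_density_iff) (auto intro!: borel_measurable_indicator simp: borel_closed closed_Times)
    then have "emeasure N A = 0"
      unfolding N_def by (subst emeasure_distr) (auto simp: space_pair_measure)
    then show "A \<in> null_sets N" by (auto simp: null_sets_def N_def)
  qed
  then obtain f where f[measurable]: "f \<in> borel_measurable lborel" and fN: "density lborel f = N"
    using sigma_finite_measure.Radon_Nikodym[OF sigma_finite_lborel, of N] by (auto simp: N_def)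
  have "(\<integral>\<^sup>+t. f t \<partial>lborel) = emeasure N UNIV"
    unfolding fN[symmetric] by (simp add: emeasure_density)
  also have "\<dots> = 1"
    unfolding N_def by (subst emeasure_distr) (auto simp: space_pair_measure arc_measure.emeasure_pair_measure_Times emeasure_arc_measure_UNIV simp flip: UNIV_Times_UNIV)
  finally have f1: "(\<integral>\<^sup>+t. f t \<partial>lborel) = 1" .
  \<comment> \<open>Total mass one makes the extended density finite almost everywhere, so it has a
    real-valued version.\<close>
  then have "AE t in lborel. f t \<noteq> \<infinity>" by (intro nn_integral_noteq_infinite) auto
  then have fe: "AE t in lborel. f t = ennreal (enn2real (f t))"
    by eventually_elim (simp add: less_top)
  define \<kappa> where "\<kappa> = (\<lambda>t. enn2real (f t))"
  have \<kappa>: "\<kappa> \<in> borel_measurable borel" "\<And>t. 0 \<le> \<kappa> t" unfolding \<kappa>_def by auto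
  have N\<kappa>: "N = density lborel (\<lambda>t. ennreal (\<kappa> t))"
    unfolding fN[symmetric] using fe \<kappa> by (intro density_cong) (auto simp: \<kappa>_def)
  have "(\<integral>\<^sup>+t. ennreal (\<kappa> t) \<partial>lborel) = 1"
    unfolding f1[symmetric] using fe by (intro nn_integral_cong_AE) (auto simp: \<kappa>_def)
  then have "integrable lborel \<kappa>"
    using \<kappa> by (intro integrableI_nonneg) auto
  moreover have "(LINT p|(arc_measure \<Otimes>\<^sub>M arc_measure). F (circ (snd p) - circ (fst p))) = (LINT t|lborel. \<kappa> t * F t)"
    if [measurable]: "F \<in> borel_measurable borel" for F :: "real^2 \<Rightarrow> real"
  proof -
    have "(LINT p|(arc_measure \<Otimes>\<^sub>M arc_measure). F (\<Phi> p)) = (LINT t|N. F t)"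
      unfolding N_def by (subst integral_distr) auto
    also have "\<dots> = (LINT t|lborel. \<kappa> t *\<^sub>R F t)"
      unfolding N\<kappa> using \<kappa> by (subst integral_density) auto
    finally show ?thesis by (simp add: \<Phi>_def)
  qed
  ultimately show thesis by (rule that)
qed

section \<open>Arc averages in \<open>L2\<close>\<close>

definition circ_avg :: "real \<Rightarrow> (real^2 \<Rightarrow> real) \<Rightarrow> real^2 \<Rightarrow> real" where
  "circ_avg l h x = (LINT u|arc_measure. h (x + l *\<^sub>R circ u))"

lemma borel_measurable_circ_avg [measurable]:
  assumes [measurable]: "h \<in> borel_measurable borel"
  shows "circ_avg l h \<in> borel_measurable borel"
  unfolding circ_avg_def by measurable

text \<open>The square of an average is a double average over pairs of angles. Integrating in
  \<open>x\<close> first, a translation turns the product of \<open>h\<close> at two arc points into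
  an autocorrelation at \<open>l\<close> times their chord.\<close>

lemma circ_avg_square:
  assumes "integrable lborel h" "\<And>x. \<bar>h x\<bar> \<le> 1"
  shows "integrable lborel (\<lambda>x. (circ_avg l h x)\<^sup>2)"
    and "(LINT x|lborel. (circ_avg l h x)\<^sup>2) = (LINT p|(arc_measure \<Otimes>\<^sub>M arc_measure). autocorr h (l *\<^sub>R (circ (snd p) - circ (fst p))))"
proof -
  have [measurable]: "h \<in> borel_measurable borel" using assms by (auto dest: borel_measurable_integrable)
  interpret P: finite_measure "arc_measure \<Otimes>\<^sub>M arc_measure"
    by (intro finite_measure_pair_measure arc_measure.finite_measure_axioms)
  interpret Q: pair_sigma_finite "arc_measure \<Otimes>\<^sub>M arc_measure" "lborel :: (real^2) measure" ..
  define G where "G = (\<lambda>p x. h (x + l *\<^sub>R circ (fst p)) * h (x + l *\<^sub>R circ (snd p)))"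
  have [measurable]: "(\<lambda>(p, x). G p x) \<in> borel_measurable ((arc_measure \<Otimes>\<^sub>M arc_measure) \<Otimes>\<^sub>M lborel)"
    unfolding G_def by measurable
  have Gi: "integrable lborel (G p)" for p
    unfolding G_def by (rule integrable_mult_bounded[OF integrable_translate(1)[OF assms(1)], where B=1]) (use assms in auto)
  have Gb: "(LINT x|lborel. \<bar>G p x\<bar>) \<le> (LINT x|lborel. \<bar>h x\<bar>)" for p
  proof -
    have "(LINT x|lborel. \<bar>G p x\<bar>) \<le> (LINT x|lborel. \<bar>h (x + l *\<^sub>R circ (fst p))\<bar>)"
    proof (rule integral_mono)
      show "integrable lborel (\<lambda>x. \<bar>G p x\<bar>)" by (rule integrable_abs[OF Gi])
      show "integrable lborel (\<lambda>x. \<bar>h (x + l *\<^sub>R circ (fst p))\<bar>)"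
        by (rule integrable_abs[OF integrable_translate(1)[OF assms(1)]])
      show "\<bar>G p x\<bar> \<le> \<bar>h (x + l *\<^sub>R circ (fst p))\<bar>" for x
        using assms(2) by (simp add: G_def abs_mult mult_left_le)
    qed
    also have "\<dots> = (LINT x|lborel. \<bar>h x\<bar>)"
      by (rule integrable_translate(2)) (use assms in simp)
    finally show ?thesis .
  qed
  \<comment> \<open>Each \<open>G p\<close> has \<open>L1\<close> norm at most that of
    \<open>h\<close>, and \<open>p\<close> ranges over a finite measure space.\<close>
  have int: "integrable ((arc_measure \<Otimes>\<^sub>M arc_measure) \<Otimes>\<^sub>M lborel) (\<lambda>(p, x). G p x)"
  proof (rule Q.Fubini_integrable)
    have [measurable]: "(\<lambda>p. LINT x|lborel. \<bar>G p x\<bar>) \<in> borel_measurable (arc_measure \<Otimes>\<^sub>M arc_measure)" unfolding G_def by measurable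
    have "integrable (arc_measure \<Otimes>\<^sub>M arc_measure) (\<lambda>p. LINT x|lborel. \<bar>G p x\<bar>)"
      by (rule P.integrable_const_bound[where B="LINT x|lborel. \<bar>h x\<bar>"]) (use Gb in auto)
    then show "integrable (arc_measure \<Otimes>\<^sub>M arc_measure) (\<lambda>p. LINT x|lborel. norm (case (p, x) of (p, x) \<Rightarrow> G p x))" by simp
  qed (use Gi in auto)
  have inner: "(LINT p|(arc_measure \<Otimes>\<^sub>M arc_measure). G p x) = (circ_avg l h x)\<^sup>2" for x
  proof -
    have "integrable (arc_measure \<Otimes>\<^sub>M arc_measure) (\<lambda>(u, v). h (x + l *\<^sub>R circ u) * h (x + l *\<^sub>R circ v))"
      by (rule P.integrable_const_bound[where B=1]) (use assms(2) mult_mono[OF assms(2) assms(2)] in \<open>auto simp: abs_mult\<close>)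
    from arc_measure_pair.integral_fst[OF this]
    have "(LINT p|(arc_measure \<Otimes>\<^sub>M arc_measure). G p x) = (LINT u|arc_measure. LINT v|arc_measure. h (x + l *\<^sub>R circ u) * h (x + l *\<^sub>R circ v))"
      by (simp add: G_def case_prod_unfold)
    then show ?thesis by (simp add: circ_avg_def power2_eq_square)
  qed
  have outer: "(LINT x|lborel. G p x) = autocorr h (l *\<^sub>R (circ (snd p) - circ (fst p)))" for p
  proof -
    have "integrable lborel (\<lambda>x. h (x + l *\<^sub>R (circ (snd p) - circ (fst p))) * h x)"
      by (rule integrable_mult_bounded[OF assms(1), where B=1]) (use assms(2) in auto)
    from integrable_translate(2)[OF this, of "l *\<^sub>R circ (fst p)"]
    show ?thesis unfolding G_def autocorr_def by (simp add: algebra_simps)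
  qed
  show "integrable lborel (\<lambda>x. (circ_avg l h x)\<^sup>2)"
    using Q.integrable_snd[OF int] by (simp add: inner)
  show "(LINT x|lborel. (circ_avg l h x)\<^sup>2) = (LINT p|(arc_measure \<Otimes>\<^sub>M arc_measure). autocorr h (l *\<^sub>R (circ (snd p) - circ (fst p))))"
    using Q.Fubini_integral[OF int] by (simp add: inner outer)
qed

text \<open>The squared \<open>L2\<close> norm is the autocorrelation integrated against the chord
  density, which is integrable. The constant \<open>c\<close> depends only on \<open>\<eta>\<close>,
  since that density is fixed.\<close>

lemma circ_avg_detail_small:
  assumes "\<eta> > 0"
  obtains c where "c > 0" "\<And>l \<rho> g. l > 0 \<Longrightarrow> \<rho> > 0 \<Longrightarrow> \<rho> \<le> c * l \<Longrightarrow> integrable lborel g \<Longrightarrow>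
    (\<And>x. 0 \<le> g x) \<Longrightarrow> (\<And>x. g x \<le> 1) \<Longrightarrow>
      (LINT x|lborel. (circ_avg l (detail \<rho> g) x)\<^sup>2) \<le> \<eta> * (LINT x|lborel. g x)"
proof -
  obtain \<kappa> :: "real^2 \<Rightarrow> real" where \<kappa>: "integrable lborel \<kappa>"
    "\<And>F :: real^2 \<Rightarrow> real. F \<in> borel_measurable borel \<Longrightarrow>
      (LINT p|(arc_measure \<Otimes>\<^sub>M arc_measure). F (circ (snd p) - circ (fst p))) = (LINT t|lborel. \<kappa> t * F t)"
    by (rule chord_density) blast
  obtain c where c: "c > 0" "\<And>l \<rho> g. l > 0 \<Longrightarrow> \<rho> > 0 \<Longrightarrow> \<rho> \<le> c * l \<Longrightarrow> integrable lborel g \<Longrightarrow>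
    (\<And>x. 0 \<le> g x) \<Longrightarrow> (\<And>x. g x \<le> 1) \<Longrightarrow>
      \<bar>LINT t|lborel. \<kappa> t * autocorr (detail \<rho> g) (l *\<^sub>R t)\<bar> \<le> \<eta> * (LINT x|lborel. g x)"
    by (rule averages_detailD[OF averages_detail_integrable[OF \<kappa>(1)] assms]) blast
  show thesis
  proof (rule that[OF c(1)])
    fix l \<rho> :: real and g :: "real^2 \<Rightarrow> real"
    assume A: "l > 0" "\<rho> > 0" "\<rho> \<le> c * l" "integrable lborel g" and g: "\<And>x. 0 \<le> g x" "\<And>x. g x \<le> 1"
    note h = integrable_detail[OF A(2,4) g] abs_detail_le[OF A(2,4) g]
    have [measurable]: "detail \<rho> g \<in> borel_measurable borel" using h(1) by (auto dest: borel_measurable_integrable)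
    have "(LINT x|lborel. (circ_avg l (detail \<rho> g) x)\<^sup>2) = (LINT t|lborel. \<kappa> t * autocorr (detail \<rho> g) (l *\<^sub>R t))"
      unfolding circ_avg_square(2)[OF h] by (rule \<kappa>(2)) measurable
    then show "(LINT x|lborel. (circ_avg l (detail \<rho> g) x)\<^sup>2) \<le> \<eta> * (LINT x|lborel. g x)"
      using c(2)[OF A g] by linarith
  qed
qed

section \<open>Correlations and the joint density\<close>

text \<open>A limit superior above some real \<open>\<epsilon> > 0\<close> is exceeded by values at
  arbitrarily large \<open>R\<close>. The supremum over \<open>z\<close> and the infimum over
  \<open>r\<close> are then unwound and the normalising factor is multiplied out.\<close>

lemma joint_upper_Banach_density_posD:
  assumes pos: "joint_upper_Banach_density A B > 0"
  obtains \<epsilon> M :: real where "0 < \<epsilon>" "1 \<le> M"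
    "\<And>R0. \<exists>R\<ge>R0. \<exists>z. \<forall>r\<in>{M..R / 2}. ennreal (\<epsilon> * ((2 * r)\<^sup>2 * R\<^sup>2)) \<le>
      (\<integral>\<^sup>+ x \<in> square z R. (\<integral>\<^sup>+ y. indicator A x * indicator B y * indicator (cbox (\<chi> i. - r) (\<chi> i. r)) (x - y) \<partial>lborel) \<partial>lborel)"
proof -
  define J where "J = (\<lambda>r R z. \<integral>\<^sup>+ x \<in> square z R. (\<integral>\<^sup>+ y. indicator A x * indicator B y * indicator (cbox (\<chi> i. - r) (\<chi> i. r)) (x - y) \<partial>lborel) \<partial>lborel)"
  have sq: "(+) z ` cbox 0 (\<chi> i. R) = square z R" for z :: "real^2" and R
  proof -
    have "z + (\<chi> i. R) = (\<chi> i. z $ i + R)" by (simp add: vec_eq_iff)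
    then show ?thesis by (metis add_0_right cbox_translation square_def)
  qed
  have "joint_upper_Banach_density A B = (SUP M \<in> {1::real..}. Limsup at_top (\<lambda>R::real.
      SUP z :: real ^ 2. INF r \<in> {M..R / 2}. ennreal (1 / ((2 * r)\<^sup>2 * R\<^sup>2)) * J r R z))"
    \<comment> \<open>Integrals against a completed measure agree with those against the original
      one, so \<open>lebesgue\<close> becomes \<open>lborel\<close>.\<close>
    unfolding joint_upper_Banach_density_def J_def sq nn_integral_completion ..
  then obtain M :: real where M: "1 \<le> M" and "0 < Limsup at_top (\<lambda>R::real.
      SUP z :: real ^ 2. INF r \<in> {M..R / 2}. ennreal (1 / ((2 * r)\<^sup>2 * R\<^sup>2)) * J r R z)"
    using pos by (auto simp: less_SUP_iff)
  moreover define F where "F = (\<lambda>R. SUP z :: real ^ 2. INF r \<in> {M..R / 2}. ennreal (1 / ((2 * r)\<^sup>2 * R\<^sup>2)) * J r R z)"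
  \<comment> \<open>Being strictly below the limit superior, \<open>e\<close> is finite even if the
    density is infinite.\<close>
  ultimately obtain e where e: "0 < e" "e < Limsup at_top F"
    using dense by blast
  then have "e < \<infinity>" using less_le_trans[OF e(2), of top] by simp
  then obtain \<epsilon> where \<epsilon>: "e = ennreal \<epsilon>" "\<epsilon> > 0"
    using e(1) by (cases e) auto
  show thesis
  proof (rule that[OF \<epsilon>(2) M])
    fix R0 :: real
    have "\<not> (\<forall>\<^sub>F R in at_top. F R \<le> e)"
      using e(2) by (auto dest!: Limsup_bounded)
    \<comment> \<open>The lower bound 1 keeps \<open>R\<close> positive, so that \<open>q\<close>
      can be cancelled.\<close>
    then obtain R where R: "R \<ge> max 1 R0" "\<not> F R \<le> e"
      unfolding eventually_at_top_linorder by blast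
    then obtain z where z: "e < (INF r \<in> {M..R / 2}. ennreal (1 / ((2 * r)\<^sup>2 * R\<^sup>2)) * J r R z)"
      unfolding F_def not_le less_SUP_iff by blast
    have "ennreal (\<epsilon> * ((2 * r)\<^sup>2 * R\<^sup>2)) \<le> J r R z" if "r \<in> {M..R / 2}" for r
    proof -
      define q where "q = (2 * r)\<^sup>2 * R\<^sup>2"
      have q: "q > 0" using that M R by (auto simp: q_def)
      have "ennreal \<epsilon> \<le> ennreal (1 / q) * J r R z"
        using less_INF_D[OF z that] unfolding q_def \<epsilon>(1) by (rule less_imp_le)
      then have "ennreal q * ennreal \<epsilon> \<le> ennreal q * (ennreal (1 / q) * J r R z)"
        by (rule mult_left_mono) simp
      also have "\<dots> = J r R z" using q by (simp add: mult.assoc[symmetric] ennreal_mult[symmetric])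
      finally show ?thesis
        using q \<epsilon>(2) unfolding q_def[symmetric] by (simp add: ennreal_mult mult.commute)
    qed
    then show "\<exists>R\<ge>R0. \<exists>z. \<forall>r\<in>{M..R / 2}. ennreal (\<epsilon> * ((2 * r)\<^sup>2 * R\<^sup>2)) \<le>
      (\<integral>\<^sup>+ x \<in> square z R. (\<integral>\<^sup>+ y. indicator A x * indicator B y * indicator (cbox (\<chi> i. - r) (\<chi> i. r)) (x - y) \<partial>lborel) \<partial>lborel)"
      using R(1) unfolding J_def by (intro exI[of _ R] conjI exI[of _ z] ballI) auto
  qed
qed

text \<open>Inner approximation serves two purposes: Borel subsets still miss every distance missed
  by the original pair, and equality almost everywhere preserves the density integrals.\<close>

lemma lebesgue_borel_kernel:
  assumes "A \<in> sets lebesgue"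
  obtains A' where "A' \<in> sets borel" "A' \<subseteq> A" "AE x in lborel. x \<in> A \<longleftrightarrow> x \<in> A'"
proof
  show "main_part lborel A \<in> sets borel" using main_part_sets[OF assms] by simp
  show "main_part lborel A \<subseteq> A" using main_part_null_part_Un[OF assms] by blast
  obtain N where "N \<in> null_sets lborel" "null_part lborel A \<subseteq> N" using null_part[OF assms] by blast
  then show "AE x in lborel. x \<in> A \<longleftrightarrow> x \<in> main_part lborel A"
    using main_part_null_part_Un[OF assms] by (intro AE_I'[of N]) auto
qed

text \<open>A pair at sup-distance at most \<open>r\<close> either shares a cell of side
  \<open>L\<close> and is seen by the average, or its first point is within \<open>r\<close> of the
  grid, which is rare when \<open>r / L\<close> is small. The square of side \<open>3 * R\<close>
  contains all partners \<open>y\<close>, because \<open>r \<le> R\<close>.\<close>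

lemma cell_avg_correlation_ge:
  assumes A: "A \<in> sets borel" and B: "B \<in> sets borel"
    and r: "0 < r" "r \<le> L" "L \<le> R" "L > 0"
    and dens: "ennreal (\<epsilon> * ((2 * r)\<^sup>2 * R\<^sup>2)) \<le>
      (\<integral>\<^sup>+ x \<in> square z R. (\<integral>\<^sup>+ y. indicator A x * indicator B y * indicator (cbox (\<chi> i. - r) (\<chi> i. r)) (x - y) \<partial>lborel) \<partial>lborel)"
    and \<epsilon>: "\<epsilon> > 0"
  defines "f \<equiv> indicat_real (A \<inter> square z R)"
    and "g \<equiv> indicat_real (B \<inter> square (\<chi> i. z $ i - R) (3 * R))"
  shows "4 * (r / L)\<^sup>2 * (\<epsilon> - 16 * (r / L)) * R\<^sup>2 \<le> (LINT x|lborel. f x * cell_avg L g x)"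
proof -
  note [measurable] = A B
  have sqf: "emeasure lborel (S \<inter> square w s) < \<infinity>" if "S \<in> sets borel" "s \<ge> 0" for S w s
    using emeasure_mono[of "S \<inter> square w s" "square w s" lborel] emeasure_square[OF that(2), of w]
    by (auto intro: le_less_trans)
  have fi: "integrable lborel f" and gi: "integrable lborel g"
    unfolding f_def g_def using sqf r by (auto intro!: integrable_real_indicator)
  have f01: "0 \<le> f x" "f x \<le> 1" "\<bar>f x\<bar> \<le> 1" and g01: "0 \<le> g x" "g x \<le> 1" for x
    by (auto simp: f_def g_def indicator_def)
  have [measurable]: "f \<in> borel_measurable borel" "g \<in> borel_measurable borel"
    unfolding f_def g_def by measurable
  have fEi: "integrable lborel (\<lambda>x. f x * cell_avg L g x)"
    by (rule cell_avg_self_adjoint(2)[OF r(4) fi f01(3) gi])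
  have E0: "0 \<le> cell_avg L g x" for x by (rule cell_avg_bounds[OF r(4) gi g01])
  let ?C = "cbox (\<chi> i. - r) (\<chi> i. r) :: (real^2) set"
  have mC: "x - y \<in> ?C \<longleftrightarrow> (\<forall>i. \<bar>x $ i - y $ i\<bar> \<le> r)" for x y
    unfolding mem_box_cart by (intro iff_allI) auto
  have inner: "indicator (square z R) x * (\<integral>\<^sup>+ y. indicator A x * indicator B y * indicator ?C (x - y) \<partial>lborel)
     \<le> ennreal (L\<^sup>2 * (f x * cell_avg L g x)) + ennreal (4 * r\<^sup>2) * indicator (near_grid L r \<inter> square z R) x" for x
  proof (cases "x \<in> A \<inter> square z R")
    case False
    then show ?thesis by (auto simp: indicator_def)
  next
    case True
    then have fx: "f x = 1" by (simp add: f_def)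
    have "(\<integral>\<^sup>+ y. indicator A x * indicator B y * indicator ?C (x - y) \<partial>lborel)
      \<le> (\<integral>\<^sup>+ y. ennreal (L\<^sup>2) * ennreal (cell_kernel L x y * g y) + indicator (near_grid L r) x * indicator (square (\<chi> i. x $ i - r) (2 * r)) y \<partial>lborel)"
    proof (rule nn_integral_mono)
      fix y
      show "indicator A x * indicator B y * indicator ?C (x - y)
        \<le> ennreal (L\<^sup>2) * ennreal (cell_kernel L x y * g y) + indicator (near_grid L r) x * indicator (square (\<chi> i. x $ i - r) (2 * r)) y"
      proof (cases "y \<in> B \<and> x - y \<in> ?C")
        case False
        then show ?thesis by (auto simp: indicator_def)
      next
        case yB: True
        then have d: "\<bar>x $ i - y $ i\<bar> \<le> r" for i by (simp add: mC)
        show ?thesis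
        proof (cases "same_cell L x y")
          case sc: True
          have "y \<in> square (\<chi> i. z $ i - R) (3 * R)"
            unfolding mem_square
          proof
            fix i
            have "z $ i \<le> x $ i" "x $ i \<le> z $ i + R" using True by (auto simp: mem_square)
            then show "(\<chi> i. z $ i - R) $ i \<le> y $ i \<and> y $ i \<le> (\<chi> i. z $ i - R) $ i + 3 * R"
              using d[of i] r by auto
          qed
          then have "g y = 1" using yB by (simp add: g_def)
          \<comment> \<open>The factor \<open>L\<^sup>2\<close> cancels the height of the kernel, so
            a pair in one cell has weight exactly one.\<close>
          then have "ennreal (L\<^sup>2) * ennreal (cell_kernel L x y * g y) = 1"
            using sc r by (simp add: cell_kernel_def ennreal_mult[symmetric])
          then show ?thesis by (auto simp: indicator_def)
        next
          case False
          have "x \<in> near_grid L r" by (rule not_same_cell_imp_near_grid[OF r(4) d False])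
          moreover have "y \<in> square (\<chi> i. x $ i - r) (2 * r)"
            unfolding mem_square
          proof
            fix i show "(\<chi> i. x $ i - r) $ i \<le> y $ i \<and> y $ i \<le> (\<chi> i. x $ i - r) $ i + 2 * r"
              using d[of i] by auto
          qed
          ultimately show ?thesis by (auto simp: indicator_def)
        qed
      qed
    qed
    also have "\<dots> = ennreal (L\<^sup>2) * (\<integral>\<^sup>+ y. ennreal (cell_kernel L x y * g y) \<partial>lborel) + indicator (near_grid L r) x * emeasure lborel (square (\<chi> i. x $ i - r) (2 * r))"
      by (subst nn_integral_add) (auto simp: nn_integral_cmult)
    also have "(\<integral>\<^sup>+ y. ennreal (cell_kernel L x y * g y) \<partial>lborel) = ennreal (cell_avg L g x)"
      unfolding cell_avg_def by (rule nn_integral_eq_integral[OF integrable_cell_kernel_mult[OF gi]]) (auto simp: g01)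
    also have "emeasure lborel (square (\<chi> i. x $ i - r) (2 * r)) = ennreal (4 * r\<^sup>2)"
      using r by (subst emeasure_square) (auto simp: power2_eq_square)
    finally show ?thesis using True fx E0 by (auto simp: ennreal_mult indicator_def)
  qed
  have near: "emeasure lborel (near_grid L r \<inter> square z R) \<le> ennreal (16 * (r / L) * R\<^sup>2)"
    using r by (intro emeasure_near_grid_le) auto
  have "ennreal (\<epsilon> * ((2 * r)\<^sup>2 * R\<^sup>2)) \<le> (\<integral>\<^sup>+ x. ennreal (L\<^sup>2 * (f x * cell_avg L g x)) + ennreal (4 * r\<^sup>2) * indicator (near_grid L r \<inter> square z R) x \<partial>lborel)"
    by (rule order_trans[OF dens nn_integral_mono]) (use inner in \<open>simp add: mult.commute\<close>)
  also have "\<dots> = (\<integral>\<^sup>+ x. ennreal (L\<^sup>2 * (f x * cell_avg L g x)) \<partial>lborel) + ennreal (4 * r\<^sup>2) * emeasure lborel (near_grid L r \<inter> square z R)"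
    by (subst nn_integral_add) (auto simp: nn_integral_cmult_indicator)
  also have "(\<integral>\<^sup>+ x. ennreal (L\<^sup>2 * (f x * cell_avg L g x)) \<partial>lborel) = ennreal (LINT x|lborel. L\<^sup>2 * (f x * cell_avg L g x))"
    by (rule nn_integral_eq_integral) (use fEi f01 E0 in auto)
  also have "ennreal (4 * r\<^sup>2) * emeasure lborel (near_grid L r \<inter> square z R) \<le> ennreal (4 * r\<^sup>2) * ennreal (16 * (r / L) * R\<^sup>2)"
    by (rule mult_left_mono[OF near]) simp
  finally have "ennreal (\<epsilon> * ((2 * r)\<^sup>2 * R\<^sup>2)) \<le> ennreal (LINT x|lborel. L\<^sup>2 * (f x * cell_avg L g x)) + ennreal (4 * r\<^sup>2) * ennreal (16 * (r / L) * R\<^sup>2)"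
    by (simp add: add_left_mono)
  also have "\<dots> = ennreal (L\<^sup>2 * (LINT x|lborel. f x * cell_avg L g x) + 4 * r\<^sup>2 * (16 * (r / L) * R\<^sup>2))"
    using r f01 E0 by (subst ennreal_mult[symmetric]) (auto simp: ennreal_plus[symmetric] simp del: ennreal_plus)
  finally have "\<epsilon> * ((2 * r)\<^sup>2 * R\<^sup>2) \<le> L\<^sup>2 * (LINT x|lborel. f x * cell_avg L g x) + 4 * r\<^sup>2 * (16 * (r / L) * R\<^sup>2)"
    using r f01 E0 by (subst (asm) ennreal_le_iff) auto
  then have "(\<epsilon> * ((2 * r)\<^sup>2 * R\<^sup>2) - 4 * r\<^sup>2 * (16 * (r / L) * R\<^sup>2)) / L\<^sup>2 \<le> (LINT x|lborel. f x * cell_avg L g x)"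
    using r by (simp add: divide_le_eq mult.commute)
  also have "(\<epsilon> * ((2 * r)\<^sup>2 * R\<^sup>2) - 4 * r\<^sup>2 * (16 * (r / L) * R\<^sup>2)) / L\<^sup>2 = 4 * (r / L)\<^sup>2 * (\<epsilon> - 16 * (r / L)) * R\<^sup>2"
    using r by (simp add: power_divide power_mult_distrib field_simps)
  finally show ?thesis .
qed

section \<open>Large distances\<close>

text \<open>Pointwise \<open>2 * a * b \<le> a^2 + b^2\<close>, combined with translation
  invariance.\<close>

lemma autocorr_le_square_integral:
  assumes "integrable lborel d" "\<And>x. \<bar>d x\<bar> \<le> 1"
  shows "autocorr d t \<le> (LINT x|lborel. (d x)\<^sup>2)"
proof -
  have [measurable]: "d \<in> borel_measurable borel" using assms by (auto dest: borel_measurable_integrable)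
  have sq: "integrable lborel (\<lambda>x. (d x)\<^sup>2)"
    unfolding power2_eq_square by (rule integrable_mult_bounded[OF assms(1) _ assms(2)]) measurable
  note tr = integrable_translate[OF sq, of t]
  have "autocorr d t \<le> (LINT x|lborel. ((d x)\<^sup>2 + (d (x + t))\<^sup>2) / 2)"
    unfolding autocorr_def
  proof (rule integral_mono)
    have "integrable lborel (\<lambda>x. d (x + t) * d x)"
      by (rule integrable_mult_bounded[OF assms(1), where B=1]) (use assms(2) in auto)
    then show "integrable lborel (\<lambda>x. d x * d (x + t))" by (simp add: mult.commute)
    show "integrable lborel (\<lambda>x. ((d x)\<^sup>2 + (d (x + t))\<^sup>2) / 2)" using sq tr(1) by simp
    show "d x * d (x + t) \<le> ((d x)\<^sup>2 + (d (x + t))\<^sup>2) / 2" for x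
      using sum_squares_bound[of "d x" "d (x + t)"] by simp
  qed
  also have "\<dots> = (LINT x|lborel. (d x)\<^sup>2)" using sq tr by simp
  finally show ?thesis .
qed

text \<open>The left side averages autocorrelations of \<open>d\<close> over a probability measure,
  and each of them is at most the right side.\<close>

lemma circ_avg_contraction:
  assumes "integrable lborel d" "\<And>x. \<bar>d x\<bar> \<le> 1"
  shows "(LINT x|lborel. (circ_avg l d x)\<^sup>2) \<le> (LINT x|lborel. (d x)\<^sup>2)"
proof -
  interpret P: finite_measure "arc_measure \<Otimes>\<^sub>M arc_measure"
    by (intro finite_measure_pair_measure arc_measure.finite_measure_axioms)
  have [measurable]: "d \<in> borel_measurable borel" using assms by (auto dest: borel_measurable_integrable)
  have "measure (arc_measure \<Otimes>\<^sub>M arc_measure) UNIV = 1"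
    using arc_measure.emeasure_pair_measure_Times[of UNIV arc_measure UNIV] by (simp add: measure_def emeasure_arc_measure_UNIV)
  moreover have "(LINT p|(arc_measure \<Otimes>\<^sub>M arc_measure). autocorr d (l *\<^sub>R (circ (snd p) - circ (fst p)))) \<le> (LINT p|(arc_measure \<Otimes>\<^sub>M arc_measure). (LINT x|lborel. (d x)\<^sup>2))"
  proof (rule integral_mono)
    show "integrable (arc_measure \<Otimes>\<^sub>M arc_measure) (\<lambda>p. autocorr d (l *\<^sub>R (circ (snd p) - circ (fst p))))"
      by (rule P.integrable_const_bound[where B="LINT x|lborel. \<bar>d x\<bar>"]) (use abs_autocorr_le[OF assms] in auto)
  qed (use autocorr_le_square_integral[OF assms] in auto)
  ultimately show ?thesis
    unfolding circ_avg_square(2)[OF assms] by (simp add: space_pair_measure)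
qed

text \<open>On \<open>S\<close> the arc average of \<open>g\<close> vanishes, so the arc average of
  its coarse part is minus those of the two finer parts. The coarse part is constant along the arc
  unless the centre is near the grid, and the finer parts are controlled in
  \<open>L2\<close>.\<close>

lemma cell_avg_correlation_le:
  assumes f: "S \<in> sets borel" "S \<subseteq> square z R" and R: "l \<le> L" "L \<le> R"
    and g: "integrable lborel g" "\<And>x. 0 \<le> g x" "\<And>x. g x \<le> 1"
    and \<rho>: "\<rho> > 0" "n > 0" "L = of_nat n * \<rho>" and l: "l > 0" and a: "a > 0"
    and avoid: "\<And>x u. x \<in> S \<Longrightarrow> g (x + l *\<^sub>R circ u) = 0"
  shows "(LINT x|lborel. indicator S x * cell_avg L g x) \<le> 16 * (l / L) * R\<^sup>2 + a * R\<^sup>2 +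
    ((LINT x|lborel. g x * cell_avg \<rho> g x) - (LINT x|lborel. g x * cell_avg L g x)
      + (LINT x|lborel. (circ_avg l (detail \<rho> g) x)\<^sup>2)) / (2 * a)"
proof -
  have L: "L > 0" "R > 0" using \<rho> R l by auto
  define d where "d = (\<lambda>x. cell_avg \<rho> g x - cell_avg L g x)"
  note [measurable] = f(1)
  have [measurable]: "g \<in> borel_measurable borel" using g by (auto dest: borel_measurable_integrable)
  have E: "0 \<le> cell_avg \<tau> g x" "cell_avg \<tau> g x \<le> 1" if "\<tau> > 0" for \<tau> x
    using cell_avg_bounds[OF that g] by auto
  have Ei: "integrable lborel (cell_avg \<tau> g)" if "\<tau> > 0" for \<tau> using integrable_cell_avg[OF that g(1)] .
  have di: "integrable lborel d" using Ei[OF \<rho>(1)] Ei[OF L(1)] by (simp add: d_def)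
  have d1: "\<bar>d x\<bar> \<le> 1" for x using E[OF \<rho>(1), of x] E[OF L(1), of x] by (simp add: d_def)
  have [measurable]: "d \<in> borel_measurable borel" "detail \<rho> g \<in> borel_measurable borel"
    unfolding d_def detail_def[abs_def] by measurable
  note h = integrable_detail[OF \<rho>(1) g] abs_detail_le[OF \<rho>(1) g]
  have Sm: "emeasure lborel S \<le> ennreal (R\<^sup>2)"
    using emeasure_mono[OF f(2), of lborel] emeasure_square[of R z] L by simp
  then have Sfin: "emeasure lborel S < \<infinity>" by (auto intro: le_less_trans)
  have Sm': "measure lborel S \<le> R\<^sup>2" using Sm by (simp add: measure_def enn2real_leI)
  let ?N = "near_grid L l \<inter> square z R"
  have Nm: "emeasure lborel ?N \<le> ennreal (16 * (l / L) * R\<^sup>2)"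
    using R l L by (intro emeasure_near_grid_le) auto
  then have Nfin: "emeasure lborel ?N < \<infinity>" by (auto intro: le_less_trans)
  have Nm': "measure lborel ?N \<le> 16 * (l / L) * R\<^sup>2"
    unfolding measure_def using Nm l L by (intro enn2real_leI) auto
  have arc_int: "integrable arc_measure (\<lambda>u. q (x + l *\<^sub>R circ u))" if [measurable]: "q \<in> borel_measurable borel" and "\<And>x. \<bar>q x\<bar> \<le> 1" for q :: "real^2 \<Rightarrow> real" and x
    by (rule arc_measure.integrable_const_bound[where B=1]) (use that(2) in auto)
  have pointwise: "indicator S x * cell_avg L g x \<le> indicator ?N x + a * indicator S x
     + ((circ_avg l d x)\<^sup>2 + (circ_avg l (detail \<rho> g) x)\<^sup>2) / (2 * a)" for x
  proof (cases "x \<in> S")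
    case False
    then show ?thesis using a by simp
  next
    case True
    have "0 = circ_avg l g x" using avoid[OF True] by (simp add: circ_avg_def)
    also have "\<dots> = circ_avg l (\<lambda>x. cell_avg L g x + d x + detail \<rho> g x) x"
      by (simp add: d_def detail_def)
    also have "\<dots> = circ_avg l (cell_avg L g) x + circ_avg l d x + circ_avg l (detail \<rho> g) x"
      unfolding circ_avg_def using arc_int[of "cell_avg L g"] arc_int[of d] arc_int[of "detail \<rho> g"] E[OF L(1)] d1 h(2)
      by simp
    finally have split: "circ_avg l (cell_avg L g) x = - circ_avg l d x - circ_avg l (detail \<rho> g) x" by simp
    \<comment> \<open>Completing the square trades a linear term for a squared one, which can be
      integrated. Used for both finer parts, the constants \<open>a / 2\<close> add up to
      \<open>a\<close>.\<close>
    have young: "- v \<le> a / 2 + v\<^sup>2 / (2 * a)" for v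
    proof -
      have "0 \<le> (a + v)\<^sup>2 / (2 * a)" using a by simp
      also have "\<dots> = a / 2 + v + v\<^sup>2 / (2 * a)" using a by (simp add: power2_eq_square field_simps)
      finally show ?thesis by simp
    qed
    \<comment> \<open>Near the grid the bound is trivial, as averages of \<open>g\<close> lie
      between 0 and 1. Elsewhere the whole arc stays in the cell of its centre.\<close>
    have "cell_avg L g x \<le> indicator ?N x + circ_avg l (cell_avg L g) x"
    proof (cases "x \<in> ?N")
      case N: True
      have "0 \<le> circ_avg l (cell_avg L g) x" unfolding circ_avg_def using E[OF L(1)] by simp
      then show ?thesis using N E[OF L(1), of x] by simp
    next
      case N: False
      have "cell_avg L g (x + l *\<^sub>R circ u) = cell_avg L g x" for u
      proof -
        have "\<bar>x $ i - (x + l *\<^sub>R circ u) $ i\<bar> \<le> l" for i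
          using component_le_norm_cart[of "circ u" i] l by (simp add: abs_mult mult_left_le)
        from not_same_cell_imp_near_grid[OF L(1) this] N True f(2)
        have "same_cell L x (x + l *\<^sub>R circ u)" by blast
        then show ?thesis by (metis cell_avg_cong)
      qed
      then show ?thesis by (simp add: circ_avg_def)
    qed
    also have "circ_avg l (cell_avg L g) x \<le> a + ((circ_avg l d x)\<^sup>2 + (circ_avg l (detail \<rho> g) x)\<^sup>2) / (2 * a)"
      unfolding split using young[of "circ_avg l d x"] young[of "circ_avg l (detail \<rho> g) x"]
      by (simp add: add_divide_distrib)
    finally show ?thesis using True by simp
  qed
  note ci = circ_avg_square(1)[OF di d1, of l] circ_avg_square(1)[OF h, of l]
  have Si: "integrable lborel (indicat_real S)" and Ni: "integrable lborel (indicat_real ?N)"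
    using Sfin Nfin by (auto intro!: integrable_real_indicator)
  have "(LINT x|lborel. indicator S x * cell_avg L g x) \<le> (LINT x|lborel. indicator ?N x + a * indicator S x
     + ((circ_avg l d x)\<^sup>2 + (circ_avg l (detail \<rho> g) x)\<^sup>2) / (2 * a))"
  proof (rule integral_mono[OF _ _ pointwise])
    show "integrable lborel (\<lambda>x. indicator S x * cell_avg L g x)"
      by (rule integrable_mult_bounded[OF Ei[OF L(1)], where B=1]) auto
    show "integrable lborel (\<lambda>x. indicator ?N x + a * indicator S x
       + ((circ_avg l d x)\<^sup>2 + (circ_avg l (detail \<rho> g) x)\<^sup>2) / (2 * a))"
      using Si Ni ci by simp
  qed
  also have "\<dots> = measure lborel ?N + a * measure lborel S
     + ((LINT x|lborel. (circ_avg l d x)\<^sup>2) + (LINT x|lborel. (circ_avg l (detail \<rho> g) x)\<^sup>2)) / (2 * a)"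
    using Si Ni ci by simp
  also have "\<dots> \<le> 16 * (l / L) * R\<^sup>2 + a * R\<^sup>2 +
    ((LINT x|lborel. (d x)\<^sup>2) + (LINT x|lborel. (circ_avg l (detail \<rho> g) x)\<^sup>2)) / (2 * a)"
    using a Nm' Sm' circ_avg_contraction[OF di d1, of l]
    by (intro add_mono divide_right_mono mult_left_mono) auto
  \<comment> \<open>The middle part costs an energy drop between the two scales, which a pigeonhole
    over scales can make small.\<close>
  also have "(LINT x|lborel. (d x)\<^sup>2) = (LINT x|lborel. g x * cell_avg \<rho> g x) - (LINT x|lborel. g x * cell_avg L g x)"
    unfolding d_def \<rho>(3) by (rule cell_avg_energy_increment[OF \<rho>(1,2) g])
  finally show ?thesis .
qed

theorem theorem1p2:
  fixes A B :: "(real ^ 2) set"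
  assumes "A \<in> sets lebesgue"
    and "B \<in> sets lebesgue"
    and "joint_upper_Banach_density A B > 0"
  shows "\<exists>l0::real. l0 > 0 \<and> (\<forall>l\<ge>l0. \<exists>x\<in>A. \<exists>y\<in>B. norm (x - y) = l)"
proof (rule ccontr)
  define bad where "bad = (\<lambda>l. \<not> (\<exists>x\<in>A. \<exists>y\<in>B. norm (x - y) = l))"
  assume "\<not> ?thesis"
  then have bad: "\<exists>l\<ge>l0. bad l" if "l0 > 0" for l0
    using that unfolding bad_def by blast
  obtain \<epsilon>' M :: real where \<epsilon>': "0 < \<epsilon>'" and M: "1 \<le> M" and dens':
    "\<And>R0. \<exists>R\<ge>R0. \<exists>z. \<forall>r\<in>{M..R / 2}. ennreal (\<epsilon>' * ((2 * r)\<^sup>2 * R\<^sup>2)) \<le>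
      (\<integral>\<^sup>+ x \<in> square z R. (\<integral>\<^sup>+ y. indicator A x * indicator B y * indicator (cbox (\<chi> i. - r) (\<chi> i. r)) (x - y) \<partial>lborel) \<partial>lborel)"
    by (rule joint_upper_Banach_density_posD[OF assms(3)]) blast
  obtain A' where A': "A' \<in> sets borel" "A' \<subseteq> A" "AE x in lborel. x \<in> A \<longleftrightarrow> x \<in> A'"
    by (rule lebesgue_borel_kernel[OF assms(1)])
  obtain B' where B': "B' \<in> sets borel" "B' \<subseteq> B" "AE x in lborel. x \<in> B \<longleftrightarrow> x \<in> B'"
    by (rule lebesgue_borel_kernel[OF assms(2)])
  note [measurable] = A'(1) B'(1)
  \<comment> \<open>The cap 1 ensures \<open>\<theta> \<le> 1 / 2\<close>. With
    \<open>r = \<theta> * L\<close> the lower bound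
    \<open>4 * \<theta>^2 * (\<epsilon> - 16 * \<theta>)\<close> equals \<open>\<beta>\<close>, and
    \<open>\<delta>\<close> makes the final quadratic error
    \<open>2 * 9 * \<delta> / (\<beta> / 2)\<close> equal to \<open>\<beta> / 4\<close>.\<close>
  define \<epsilon> where "\<epsilon> = min 1 \<epsilon>'"
  define \<theta> where "\<theta> = \<epsilon> / 32"
  define \<beta> where "\<beta> = \<epsilon> ^ 3 / 512"
  define \<delta> where "\<delta> = \<beta>\<^sup>2 / 144"
  have \<epsilon>: "0 < \<epsilon>" "\<epsilon> \<le> 1" "\<epsilon> \<le> \<epsilon>'" using \<epsilon>' by (auto simp: \<epsilon>_def)
  have \<theta>: "0 < \<theta>" "\<theta> \<le> 1 / 2" using \<epsilon> by (auto simp: \<theta>_def)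
  have \<beta>: "\<beta> > 0" and \<delta>: "\<delta> > 0" using \<epsilon> by (auto simp: \<beta>_def \<delta>_def)
  have dens: "\<exists>R\<ge>R0. \<exists>z. \<forall>r\<in>{M..R / 2}. ennreal (\<epsilon> * ((2 * r)\<^sup>2 * R\<^sup>2)) \<le>
      (\<integral>\<^sup>+ x \<in> square z R. (\<integral>\<^sup>+ y. indicator A' x * indicator B' y * indicator (cbox (\<chi> i. - r) (\<chi> i. r)) (x - y) \<partial>lborel) \<partial>lborel)" for R0
  proof -
    have eq: "(\<integral>\<^sup>+ x \<in> square z R. (\<integral>\<^sup>+ y. indicator A x * indicator B y * indicator (cbox (\<chi> i. - r) (\<chi> i. r)) (x - y) \<partial>lborel) \<partial>lborel)
      = (\<integral>\<^sup>+ x \<in> square z R. (\<integral>\<^sup>+ y. indicator A' x * indicator B' y * indicator (cbox (\<chi> i. - r) (\<chi> i. r)) (x - y) \<partial>lborel) \<partial>lborel)" for z R r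
    proof (rule nn_integral_cong_AE)
      have "(\<integral>\<^sup>+ y. indicator A x * indicator B y * indicator (cbox (\<chi> i. - r) (\<chi> i. r)) (x - y) \<partial>lborel)
        = (\<integral>\<^sup>+ y. indicator A x * indicator B' y * indicator (cbox (\<chi> i. - r) (\<chi> i. r)) (x - y) \<partial>lborel)" for x
        using B'(3) by (intro nn_integral_cong_AE) (auto elim!: eventually_mono simp: indicator_def)
      then show "AE x in lborel. (\<integral>\<^sup>+ y. indicator A x * indicator B y * indicator (cbox (\<chi> i. - r) (\<chi> i. r)) (x - y) \<partial>lborel) * indicator (square z R) x
        = (\<integral>\<^sup>+ y. indicator A' x * indicator B' y * indicator (cbox (\<chi> i. - r) (\<chi> i. r)) (x - y) \<partial>lborel) * indicator (square z R) x"
        using A'(3) by (auto elim!: eventually_mono simp: indicator_def)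
    qed
    have "ennreal (\<epsilon> * ((2 * r)\<^sup>2 * R\<^sup>2)) \<le> ennreal (\<epsilon>' * ((2 * r)\<^sup>2 * R\<^sup>2))" for r R :: real
      using \<epsilon>(3) by (intro ennreal_leI mult_right_mono) auto
    then show ?thesis using dens'[of R0] unfolding eq by (meson order_trans)
  qed
  obtain c where c: "c > 0" "\<And>l \<rho> g. l > 0 \<Longrightarrow> \<rho> > 0 \<Longrightarrow> \<rho> \<le> c * l \<Longrightarrow> integrable lborel g \<Longrightarrow>
    (\<And>x. 0 \<le> g x) \<Longrightarrow> (\<And>x. g x \<le> 1) \<Longrightarrow>
      (LINT x|lborel. (circ_avg l (detail \<rho> g) x)\<^sup>2) \<le> \<delta> * (LINT x|lborel. g x)"
    by (rule circ_avg_detail_small[OF \<delta>]) blast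
  \<comment> \<open>A missed distance \<open>l\<close> separates two consecutive scales. The clause
    with \<open>c\<close> makes the arc average of the detail small, the integer ratio nests the
    grids, \<open>64 * l / \<beta> \<le> L\<close> limits the loss near the grid to
    \<open>\<beta> / 4\<close>, and \<open>M / \<theta> \<le> L\<close> makes the radius
    \<open>\<theta> * L\<close> admissible.\<close>
  define step where "step = (\<lambda>\<rho> L. \<exists>l n. l > 0 \<and> bad l \<and> \<rho> \<le> c * l \<and> n > 0 \<and> L = real n * \<rho> \<and> 64 * l / \<beta> \<le> L \<and> l \<le> L \<and> M / \<theta> \<le> L)"
  have step: "\<exists>L. L > 0 \<and> step \<rho> L" if \<rho>: "\<rho> > 0" for \<rho>
  proof -
    have "max 1 (\<rho> / c) > 0" by simp
    from bad[OF this] obtain l where l: "l \<ge> max 1 (\<rho> / c)" "bad l" by blast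
    then have l': "l > 0" "\<rho> \<le> c * l" using c(1) by (auto simp: field_simps)
    obtain n :: nat where n: "max 1 (max (64 * l / \<beta>) (max l (M / \<theta>))) / \<rho> \<le> n"
      using real_arch_simple by blast
    then have n': "max 1 (max (64 * l / \<beta>) (max l (M / \<theta>))) \<le> real n * \<rho>"
      using \<rho> by (simp add: divide_le_eq)
    then have pos: "real n * \<rho> > 0" by linarith
    then have "n > 0" by (cases n) auto
    then have "step \<rho> (real n * \<rho>)"
      unfolding step_def using n' l l' by (intro exI[of _ l] exI[of _ n]) simp
    then show ?thesis using pos by blast
  qed
  obtain \<rho> :: "nat \<Rightarrow> real" where \<rho>: "\<And>k. \<rho> k > 0" "\<And>k. step (\<rho> k) (\<rho> (Suc k))"
    using dependent_nat_choice[of "\<lambda>_ x. x > 0" "\<lambda>_. step"] step zero_less_one by metis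
  have mono: "\<rho> k \<le> \<rho> (Suc k)" for k
  proof -
    obtain n :: nat where "n > 0" "\<rho> (Suc k) = real n * \<rho> k" using \<rho>(2)[of k] by (auto simp: step_def)
    moreover from this have "real n \<ge> 1" by simp
    ultimately show ?thesis using \<rho>(1)[of k] by (simp add: mult_le_cancel_right1)
  qed
  \<comment> \<open>The number of scale steps for the pigeonhole. It depends on
    \<open>\<delta>\<close> only and is fixed before the large square is chosen.\<close>
  obtain K :: nat where K: "1 / \<delta> \<le> K" using real_arch_simple by blast
  then have K0: "K > 0" using \<delta> by (cases K) (auto simp: divide_le_0_iff)
  \<comment> \<open>A single square, larger than the coarsest scale used, serves all
    \<open>K\<close> steps.\<close>
  obtain R z where R: "R \<ge> \<rho> K" and Rz: "\<And>r. r \<in> {M..R / 2} \<Longrightarrow> ennreal (\<epsilon> * ((2 * r)\<^sup>2 * R\<^sup>2)) \<le>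
      (\<integral>\<^sup>+ x \<in> square z R. (\<integral>\<^sup>+ y. indicator A' x * indicator B' y * indicator (cbox (\<chi> i. - r) (\<chi> i. r)) (x - y) \<partial>lborel) \<partial>lborel)"
    using dens[of "\<rho> K"] by blast
  have R0: "R > 0" using R \<rho>(1)[of K] by linarith
  have \<rho>R: "\<rho> k \<le> R" if "k \<le> K" for k
    using lift_Suc_mono_le[of \<rho>, OF mono that] R by linarith
  define S where "S = A' \<inter> square z R"
  define T where "T = B' \<inter> square (\<chi> i. z $ i - R) (3 * R)"
  define g where "g = indicat_real T"
  have [measurable]: "S \<in> sets borel" "T \<in> sets borel" by (simp_all add: S_def T_def)
  have Tm: "emeasure lborel T \<le> ennreal (9 * R\<^sup>2)"
    using emeasure_mono[of T "square (\<chi> i. z $ i - R) (3 * R)" lborel] R0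
    by (auto simp: T_def emeasure_square power_mult_distrib)
  have gi: "integrable lborel g" and g01: "\<And>x. 0 \<le> g x" "\<And>x. g x \<le> 1"
    unfolding g_def using Tm by (auto intro!: integrable_real_indicator intro: le_less_trans simp: indicator_def)
  have gI: "(LINT x|lborel. g x) \<le> 9 * R\<^sup>2"
    unfolding g_def using Tm by (simp add: measure_def enn2real_leI)
  define e where "e = (\<lambda>k. LINT x|lborel. g x * cell_avg (\<rho> k) g x)"
  \<comment> \<open>Pigeonhole: the drops telescope to at most \<open>9 * R\<^sup>2\<close>, the
    area of the tripled square, so all \<open>K\<close> of them cannot exceed a fraction
    \<open>\<delta> \<ge> 1 / K\<close> of it.\<close>
  have "\<exists>k<K. e k - e (Suc k) \<le> 9 * R\<^sup>2 * \<delta>"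
  proof (rule ccontr)
    assume "\<not> ?thesis"
    then have "(\<Sum>k<K. e k - e (Suc k)) > (\<Sum>k<K. 9 * R\<^sup>2 * \<delta>)"
      using K0 by (intro sum_strict_mono) (auto simp: not_le)
    moreover have "(\<Sum>k<K. e k - e (Suc k)) = e 0 - e K" by (rule sum_lessThan_telescope')
    moreover have "e K \<ge> 0"
      unfolding e_def using g01 cell_avg_bounds[OF \<rho>(1) gi g01] by simp
    moreover have "e 0 \<le> 9 * R\<^sup>2"
    proof -
      have "e 0 \<le> (LINT x|lborel. g x)"
        unfolding e_def
      proof (rule integral_mono)
        show "integrable lborel (\<lambda>x. g x * cell_avg (\<rho> 0) g x)"
          by (rule cell_avg_self_adjoint(2)[OF \<rho>(1) gi _ gi, where B=1]) (use g01 in auto)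
        show "g x * cell_avg (\<rho> 0) g x \<le> g x" for x
          using g01 cell_avg_bounds[OF \<rho>(1) gi g01] by (intro mult_left_le) auto
      qed (rule gi)
      then show ?thesis using gI by linarith
    qed
    moreover have "9 * R\<^sup>2 \<le> real K * (9 * R\<^sup>2 * \<delta>)"
    proof -
      have "1 \<le> real K * \<delta>" using K \<delta> by (simp add: divide_le_eq)
      from mult_left_mono[OF this, of "9 * R\<^sup>2"] show ?thesis by (simp add: mult_ac)
    qed
    ultimately show False by simp
  qed
  then obtain k where k: "k < K" "e k - e (Suc k) \<le> 9 * R\<^sup>2 * \<delta>" by blast
  obtain l n where l: "l > 0" "bad l" "\<rho> k \<le> c * l" "n > 0" "\<rho> (Suc k) = real n * \<rho> k"
    "64 * l / \<beta> \<le> \<rho> (Suc k)" "l \<le> \<rho> (Suc k)" "M / \<theta> \<le> \<rho> (Suc k)"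
    using \<rho>(2)[of k] by (auto simp: step_def)
  define L where "L = \<rho> (Suc k)"
  have L: "L > 0" "L \<le> R" using \<rho>(1) \<rho>R[of "Suc k"] k(1) by (auto simp: L_def)
  have r: "\<theta> * L \<in> {M..R / 2}"
  proof -
    have "M \<le> \<theta> * L" using l(8) \<theta> by (simp add: L_def divide_le_eq mult.commute)
    moreover have "\<theta> * L \<le> 1 / 2 * R" using \<theta> L by (intro mult_mono) auto
    ultimately show ?thesis by simp
  qed
  have "4 * (\<theta> * L / L)\<^sup>2 * (\<epsilon> - 16 * (\<theta> * L / L)) * R\<^sup>2 \<le> (LINT x|lborel. indicator S x * cell_avg L g x)"
    unfolding S_def g_def T_def
  proof (rule cell_avg_correlation_ge[OF A'(1) B'(1) _ _ L(2,1) Rz[OF r] \<epsilon>(1)])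
    show "0 < \<theta> * L" using \<theta> L by simp
    show "\<theta> * L \<le> L" using \<theta> L by simp
  qed
  moreover have "4 * (\<theta> * L / L)\<^sup>2 * (\<epsilon> - 16 * (\<theta> * L / L)) * R\<^sup>2 = \<beta> * R\<^sup>2"
    using L by (simp add: \<theta>_def \<beta>_def power2_eq_square power3_eq_cube)
  ultimately have lower: "\<beta> * R\<^sup>2 \<le> (LINT x|lborel. indicator S x * cell_avg L g x)" by (simp only:)
  \<comment> \<open>Every point of the arc is at distance exactly \<open>l\<close> from its centre
    \<open>x\<close> in \<open>A\<close>, and no point of \<open>B\<close> is.\<close>
  have avoid: "g (x + l *\<^sub>R circ u) = 0" if "x \<in> S" for x u
  proof -
    have "norm (x - (x + l *\<^sub>R circ u)) = l" using l(1) by simp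
    then have "x + l *\<^sub>R circ u \<notin> B" using l(2) that A'(2) unfolding bad_def S_def by blast
    then show ?thesis using B'(2) by (auto simp: g_def T_def indicator_def)
  qed
  define H where "H = (LINT x|lborel. (circ_avg l (detail (\<rho> k) g) x)\<^sup>2)"
  have H: "H \<le> \<delta> * (9 * R\<^sup>2)"
    unfolding H_def
    by (rule order_trans[OF c(2)[OF l(1) \<rho>(1) l(3) gi g01] mult_left_mono[OF gI]]) (use \<delta> in auto)
  \<comment> \<open>The weight is \<open>a = \<beta> / 4\<close>. Grid loss, weight term and
    quadratic terms then contribute at most \<open>\<beta> / 4 * R\<^sup>2\<close> each, which falls
    short of the lower bound \<open>\<beta> * R\<^sup>2\<close>.\<close>
  have "(LINT x|lborel. indicator S x * cell_avg L g x) \<le> 16 * (l / L) * R\<^sup>2 + \<beta> / 4 * R\<^sup>2 +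
    (e k - e (Suc k) + H) / (2 * (\<beta> / 4))"
    unfolding e_def H_def L_def[symmetric]
    by (rule cell_avg_correlation_le[where z=z and n=n]) (use l L \<rho>(1) gi g01 avoid \<beta> in \<open>auto simp: S_def L_def\<close>)
  also have "\<dots> \<le> \<beta> / 4 * R\<^sup>2 + \<beta> / 4 * R\<^sup>2 + (9 * R\<^sup>2 * \<delta> + \<delta> * (9 * R\<^sup>2)) / (2 * (\<beta> / 4))"
  proof (intro add_mono divide_right_mono mult_right_mono order_refl k(2) H)
    have "64 * l \<le> \<beta> * L" using l(6) \<beta> by (simp add: L_def divide_le_eq mult.commute)
    then show "16 * (l / L) \<le> \<beta> / 4" using L by (simp add: field_simps)
  qed (use \<beta> in auto)
  also have "\<dots> = 3 / 4 * \<beta> * R\<^sup>2"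
    using \<beta> by (simp add: \<delta>_def power2_eq_square field_simps)
  finally have "\<beta> * R\<^sup>2 \<le> 3 / 4 * \<beta> * R\<^sup>2" using lower by linarith
  moreover have "\<beta> * R\<^sup>2 > 0" using \<beta> R0 by simp
  ultimately show False by simp
qed

end
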